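(* Let $p$ and $q$ be prime numbers with $p \neq q$, let $r$ be a positive integer, and let $\Delta \subset \mathbb{R}^d$ be a $d$-dimensional lattice simplex with normalized volume $pq$. Suppose that $\Delta$ is not a lattice pyramid over any lower-dimensional lattice simplex. Then $\Delta$ is Gorenstein of index $r$ if and only if there exist nonnegative integers $s_1,s_2,s_3$ with $s_1+s_2+s_3 = d+1$ such that the following conditions are satisfied: (1) $rpq = s_1 q + s_2 p + s_3$; (2) for some ordering of the vertices of $\Delta$, $\Lambda_\Delta$ is generated by $$\Big(\underbrace{\tfrac1p,\ldots,\tfrac1p}_{s_1},\underbrace{\tfrac1q,\ldots,\tfrac1q}_{s_2},\underbrace{\tfrac1{pq},\ldots,\tfrac1{pq}}_{s_3}\Big) \in (\mathbb{R}/\mathbb{Z})^{d+1}.$$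
   Context: A lattice polytope is a convex polytope all of whose vertices have integer coordinates. The normalized volume $\mathrm{Vol}(\mathcal{P})$ of a $d$-dimensional lattice polytope $\mathcal{P}\subset\mathbb{R}^d$ is $d!$ times its Euclidean volume. For a $d$-dimensional lattice simplex $\Delta \subset \mathbb{R}^d$ with (ordered) vertices $v_0,\ldots,v_d \in \mathbb{Z}^d$, define the finite abelian group $$\Lambda_\Delta = \{(\lambda_0,\ldots,\lambda_d) \in (\mathbb{R}/\mathbb{Z})^{d+1} : \textstyle\sum_{i=0}^d \lambda_i (v_i,1) \in \mathbb{Z}^{d+1}\}$$ with componentwise addition (its order is $\mathrm{Vol}(\Delta)$). Two $d$-dimensional lattice polytopes in $\mathbb{R}^d$ are unimodularly equivalent if one is obtained from the other by $v \mapsto vU + w$ with $U \in \mathbb{Z}^{d\times d}$, $\det U = \pm 1$, $w \in \mathbb{Z}^d$. The lattice pyramid over $\mathcal{P}\subset\mathbb{R}^{d-1}$ is $\mathrm{Pyr}(\mathcal{P}) = \mathrm{conv}(\mathcal{P}\times\{0\}, (0,\ldots,0,1)) \subset \mathbb{R}^{d}$; $\Delta$ is called a lattice pyramid over a lower-dimensional lattice simplex if it is unimodularly equivalent to $\mathrm{Pyr}(\Delta')$ for some lattice simplex $\Delta'$ of dimension $d-1$. A $d$-dimensional lattice polytope $\mathcal{Q} \subset \mathbb{R}^d$ is reflexive if the origin is the unique lattice point in its interior and its dual polytope $\mathcal{Q}^\vee = \{y \in \mathbb{R}^d : \langle x,y\rangle \le 1 \text{ for all } x \in \mathcal{Q}\}$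 is also a lattice polytope. A $d$-dimensional lattice polytope $\mathcal{P} \subset \mathbb{R}^d$ is Gorenstein of index $r$ ($r \in \mathbb{Z}_{>0}$) if there exist a reflexive polytope $\mathcal{Q} \subset \mathbb{R}^d$ and $w \in \mathbb{Z}^d$ with $\mathcal{Q} = r\mathcal{P} + w$. *)

theory Defs
  imports "HOL-Analysis.Analysis" "HOL-Algebra.Product_Groups"
begin

definition int_points :: "(real ^ 'n) set" where
  "int_points = {x. \<forall>i. x $ i \<in> \<int>}"

definition vertices :: "(real ^ 'n) set \<Rightarrow> (real ^ 'n) set" where
  "vertices P = {v. v extreme_point_of P}"

definition lattice_polytope :: "(real ^ 'n) set \<Rightarrow> bool" where
  "lattice_polytope P \<longleftrightarrow> polytope P \<and> vertices P \<subseteq> int_points"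

definition full_dim :: "(real ^ 'n) set \<Rightarrow> bool" where
  "full_dim P \<longleftrightarrow> aff_dim P = int CARD('n)"

definition lattice_simplex :: "nat \<Rightarrow> (real ^ 'n) set \<Rightarrow> bool" where
  "lattice_simplex k P \<longleftrightarrow> lattice_polytope P \<and> int k simplex P"

definition normalized_volume :: "(real ^ 'n) set \<Rightarrow> real" where
  "normalized_volume P = fact CARD('n) * measure lebesgue P"

definition real_matrix :: "int ^ 'n ^ 'm \<Rightarrow> real ^ 'n ^ 'm" where
  "real_matrix U = (\<chi> i j. real_of_int (U $ i $ j))"

definition unimodularly_equivalent :: "(real ^ 'n) set \<Rightarrow> (real ^ 'n) set \<Rightarrow> bool" where
  "unimodularly_equivalent P Q \<longleftrightarrow>
     (\<exists>(U :: int ^ 'n ^ 'n) w. (det U = 1 \<or> det U = - 1) \<and> w \<in> int_points \<and>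
        Q = (\<lambda>v. v v* real_matrix U + w) ` P)"

text \<open>
  The space of one dimension less is realised as a coordinate hyperplane \<^term>\<open>{x. x $ i = 0}\<close>
  of the ambient space, so the base \<open>P\<close> below plays the role of the set usually written
  \<open>P \<times> {0}\<close>, with \<open>i\<close> in the role of the last coordinate. An index type has no distinguished last
  element; which \<open>i\<close> is taken is immaterial up to a permutation of the coordinates, which is
  unimodular. If the ambient dimension is 1, the base is the point \<open>{0}\<close>.
\<close>

definition pyramid :: "'n \<Rightarrow> (real ^ 'n) set \<Rightarrow> (real ^ 'n) set" where
  "pyramid i P = convex hull (insert (axis i 1) P)"

definition is_lattice_pyramid :: "(real ^ 'n) set \<Rightarrow> bool" where
  "is_lattice_pyramid D \<longleftrightarrow>
     (\<exists>i D'. D' \<subseteq> {x. x $ i = 0} \<and> lattice_simplex (CARD('n) - 1) D' \<and>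
        unimodularly_equivalent D (pyramid i D'))"

definition dual_polytope :: "(real ^ 'n) set \<Rightarrow> (real ^ 'n) set" where
  "dual_polytope Q = {y. \<forall>x\<in>Q. x \<bullet> y \<le> 1}"

definition reflexive :: "(real ^ 'n) set \<Rightarrow> bool" where
  "reflexive Q \<longleftrightarrow> lattice_polytope Q \<and> full_dim Q \<and>
     interior Q \<inter> int_points = {0} \<and> lattice_polytope (dual_polytope Q)"

definition gorenstein :: "nat \<Rightarrow> (real ^ 'n) set \<Rightarrow> bool" where
  "gorenstein r P \<longleftrightarrow> lattice_polytope P \<and> full_dim P \<and> r > 0 \<and>
     (\<exists>Q w. reflexive Q \<and> w \<in> int_points \<and> Q = (\<lambda>x. real r *\<^sub>R x + w) ` P)"

definition real_add_group :: "real monoid" where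
  "real_add_group = \<lparr>carrier = UNIV, monoid.mult = (+), one = 0\<rparr>"

definition RmodZ :: "real set monoid" where
  "RmodZ = real_add_group Mod \<int>"

definition mod_Z :: "real \<Rightarrow> real set" where
  "mod_Z x = \<int> #>\<^bsub>real_add_group\<^esub> x"

definition torus :: "nat \<Rightarrow> (nat \<Rightarrow> real set) monoid" where
  "torus d = product_group {..d} (\<lambda>_. RmodZ)"

text \<open>
  Elements of \<^term>\<open>RmodZ\<close> are cosets, i.e. sets of reals, so \<open>l i \<in> c i\<close> below says that the real
  number \<open>l i\<close> represents \<open>c i\<close>. For integral \<open>v 0, \<dots>, v d\<close> the condition does not depend on the
  choice of the representatives \<open>l\<close>; the two conjuncts express that the sum of the
  \<open>l i (v i, 1)\<close> is integral.
\<close>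

definition simplex_group :: "(nat \<Rightarrow> real ^ 'n) \<Rightarrow> (nat \<Rightarrow> real set) set" where
  "simplex_group v =
     {c \<in> carrier (torus CARD('n)).
        \<exists>l. (\<forall>i\<le>CARD('n). l i \<in> c i) \<and>
            (\<Sum>i\<le>CARD('n). l i *\<^sub>R v i) \<in> int_points \<and> (\<Sum>i\<le>CARD('n). l i) \<in> \<int>}"

definition vertex_ordering :: "(nat \<Rightarrow> real ^ 'n) \<Rightarrow> (real ^ 'n) set \<Rightarrow> bool" where
  "vertex_ordering v P \<longleftrightarrow> bij_betw v {..CARD('n)} (vertices P)"

definition block_element :: "nat \<Rightarrow> nat \<Rightarrow> nat \<Rightarrow> nat \<Rightarrow> nat \<Rightarrow> (nat \<Rightarrow> real set)" where
  "block_element p q s1 s2 s3 =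
     (\<lambda>i\<in>{..<s1 + s2 + s3}. mod_Z (if i < s1 then 1 / real p
                                 else if i < s1 + s2 then 1 / real q
                                 else 1 / (real p * real q)))"

end

theory Submission
  imports Defs
begin

text \<open>
  Let \<^term>\<open>V\<close> be the vertex set of the simplex. Everything is phrased in terms of the real weight
  functions on \<^term>\<open>V\<close> that combine the vertices, lifted to height one, to an integral point; they
  form a lattice (\<open>weight_lattice\<close>), and \<open>simplex_group\<close> is this lattice modulo the integral weights.
  By duality the lattice consists of the barycentric coordinates of all integral points of all
  integral degrees.

  The first half of the proof translates the Gorenstein property. A dilated and translated simplex is
  cut out by one inequality per vertex; its dual is the simplex spanned by the normalized facet
  normals. The dilate is reflexive iff its barycentric coordinates at the origin, the origin
  weights, are positive and the normalized normals are integral. Integrality of the normals says that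
  at each vertex all weights are multiples of the origin weight, and since the
  indicator of the vertex is itself a weight, the origin weight is the reciprocal of a positive
  integer. So the simplex is Gorenstein of index \<open>r\<close> iff there are positive integers \<open>m x\<close> such that
  the values of all weights at \<open>x\<close> are integer multiples of \<open>1 / m x\<close>, the function \<open>1 / m\<close> is itself a
  weight, and its total is \<open>r\<close> (\<open>gorenstein_iff_weights\<close>). One direction of the theorem follows at once: if
  the block element generates the group, its entries are such reciprocals.

  For the other direction it remains to show that the denominators lie in \<open>{p, q, p * q}\<close> and that
  \<open>1 / m\<close> generates the group. The normalized volume \<open>p * q\<close> is the absolute determinant of the edge
  vectors at any vertex (\<open>normalized_volume_simplex\<close>), and three determinants replace the structure
  theory of the group. Cramer's rule shows that \<open>p * q\<close> kills every weight modulo the integers, so \<open>m x\<close>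
  divides \<open>p * q\<close>. If \<open>m x = 1\<close>, all weights at \<open>x\<close> are integral, so the facet functional of \<open>x\<close> is an
  integral linear form with value one on an edge; completing it to a unimodular coordinate system exhibits the
  simplex as a lattice pyramid (\<open>pyramid_if_integral_weight\<close>). If no denominator were divisible by \<open>p\<close>,
  the group would be killed by \<open>q\<close>, and the inverse edge matrix, multiplied by \<open>q\<close>, would be integral, forcing
  \<open>p * q\<close> to divide a power of \<open>q\<close> (\<open>volume_dvd_exponent_power\<close>). Finally, two weights of order \<open>p\<close> that
  are independent modulo \<open>p\<close> would give an integral matrix whose determinant, \<open>p * q / p\<^sup>2\<close> times an
  integer prime to \<open>p\<close>, is not an integer; hence the elements of order \<open>p\<close> are multiples of one of them
  (\<open>prime_torsion_cyclic\<close>), likewise for \<open>q\<close>, and a Bezout combination of the two parts yields the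
  generator \<open>1 / m\<close>.
\<close>

section \<open>Volume of a simplex as a determinant\<close>

text \<open>
  Conjugation by the bijection matches the permutations of the two index types and preserves signs.
\<close>

lemma det_reindex:
  fixes A :: "'a::comm_ring_1 ^ 'n ^ 'n" and g :: "'m::finite \<Rightarrow> 'n::finite"
  assumes g: "bij g"
  shows "det (\<chi> i j. A $ g i $ g j) = det A"
proof -
  let ?F = "map_permutation UNIV g"
  have inj: "inj_on g UNIV" and gU: "bij_betw g UNIV UNIV"
    using g by (auto simp: bij_def)
  have invU: "bij_betw (inv_into UNIV g) UNIV UNIV"
    using g by (simp add: bij_imp_bij_inv)
  have bij: "bij_betw ?F {p. p permutes UNIV} {p. p permutes UNIV}"
  proof (rule bij_betw_byWitness[where f' = "map_permutation UNIV (inv_into UNIV g)"])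
    show "\<forall>p\<in>{p. p permutes UNIV}. map_permutation UNIV (inv_into UNIV g) (?F p) = p"
      using map_permutation_compose_inv[OF gU] g by (auto simp: bij_is_inj)
    show "\<forall>p\<in>{p. p permutes UNIV}. ?F (map_permutation UNIV (inv_into UNIV g) p) = p"
      using map_permutation_compose_inv[OF invU] g by (auto simp: bij_is_surj surj_f_inv_f)
    show "?F ` {p. p permutes UNIV} \<subseteq> {p. p permutes UNIV}"
      using map_permutation_permutes[OF gU] by auto
    show "map_permutation UNIV (inv_into UNIV g) ` {p. p permutes UNIV} \<subseteq> {p. p permutes UNIV}"
      using map_permutation_permutes[OF invU] by auto
  qed
  have "det A = (\<Sum>p | p permutes UNIV. of_int (sign (?F p)) * (\<Prod>i\<in>UNIV. A $ i $ ?F p i))"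
    unfolding det_def by (rule sum.reindex_bij_betw[OF bij, symmetric])
  also have "\<dots> = (\<Sum>p | p permutes UNIV. of_int (sign p) * (\<Prod>i\<in>UNIV. A $ g i $ g (p i)))"
  proof (rule sum.cong[OF refl])
    fix p :: "'m \<Rightarrow> 'm" assume p: "p \<in> {p. p permutes UNIV}"
    have "(\<Prod>i\<in>UNIV. A $ i $ ?F p i) = (\<Prod>i\<in>UNIV. A $ g i $ ?F p (g i))"
      by (rule prod.reindex_bij_betw[OF gU, symmetric])
    also have "\<dots> = (\<Prod>i\<in>UNIV. A $ g i $ g (p i))"
      by (simp add: map_permutation_apply[OF inj])
    finally show "of_int (sign (?F p)) * (\<Prod>i\<in>UNIV. A $ i $ ?F p i) =
        of_int (sign p) * (\<Prod>i\<in>UNIV. A $ g i $ g (p i))"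
      using p inj by (simp add: sign_map_permutation)
  qed
  finally show ?thesis
    by (simp add: det_def)
qed

text \<open>
  A copy of a finite type that carries a well-order, which the change of variables formula for Lebesgue measure
  requires of the index type.
\<close>

typedef ('n::finite) idx = "{..<CARD('n)} :: nat set"
  by (rule exI[of _ 0]) simp

instantiation idx :: (finite) linorder
begin
definition "x \<le> y \<longleftrightarrow> Rep_idx x \<le> Rep_idx y"
definition "x < y \<longleftrightarrow> Rep_idx x < Rep_idx y"
instance
  by standard (auto simp: less_eq_idx_def less_idx_def Rep_idx_inject[symmetric])
end

instance idx :: (finite) finite
proof
  have "inj Rep_idx"
    by (simp add: inj_on_def Rep_idx_inject)
  moreover have "finite (range Rep_idx)"
    by (simp add: type_definition.Rep_range[OF type_definition_idx])
  ultimately show "finite (UNIV :: 'a idx set)"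
    by (rule finite_imageD[rotated])
qed

instance idx :: (finite) wellorder
proof
  fix P :: "'a idx \<Rightarrow> bool" and a :: "'a idx"
  assume step: "\<And>x. (\<And>y. y < x \<Longrightarrow> P y) \<Longrightarrow> P x"
  show "P a"
  proof (induction "Rep_idx a" arbitrary: a rule: less_induct)
    case less
    show ?case
      by (rule step, rule less) (simp add: less_idx_def)
  qed
qed

lemma CARD_idx: "CARD('n::finite idx) = CARD('n)"
  by (simp add: type_definition.card[OF type_definition_idx])

text \<open>
  It suffices to compare the measures of boxes, and the preimage of a box is the box with permuted sides.
\<close>

lemma lborel_relabel_coordinates:
  fixes g :: "'m::finite \<Rightarrow> 'n::finite"
  assumes g: "bij g"
  shows "lborel = distr lborel borel (\<lambda>x :: real ^ 'm. (\<chi> i. x $ inv_into UNIV g i) :: real ^ 'n)"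
proof (rule lborel_eqI)
  let ?f = "\<lambda>x :: real ^ 'm. (\<chi> i. x $ inv_into UNIV g i) :: real ^ 'n"
  fix l u :: "real ^ 'n"
  assume le: "\<And>b. b \<in> Basis \<Longrightarrow> l \<bullet> b \<le> u \<bullet> b"
  have le': "l $ i \<le> u $ i" for i
    using le[of "axis i 1"] by (simp add: inner_axis)
  have cont: "continuous_on UNIV ?f"
    by (intro continuous_intros)
  have [measurable]: "?f \<in> borel \<rightarrow>\<^sub>M borel"
    using borel_measurable_continuous_onI[OF cont] by simp
  have inv: "inv_into UNIV g (g i) = i" "g (inv_into UNIV g j) = j" for i j
    using g by (auto simp: bij_is_inj bij_is_surj surj_f_inv_f)
  have pre: "?f -` box l u = box (\<chi> i. l $ g i) (\<chi> i. u $ g i)"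
    by (auto simp: mem_box_cart) (metis inv)+
  have "emeasure (distr lborel borel ?f) (box l u) = emeasure lborel (box (\<chi> i. l $ g i) (\<chi> i. u $ g i) :: (real ^ 'm) set)"
    by (subst emeasure_distr) (auto simp: pre)
  also have "\<dots> = (\<Prod>b\<in>Basis. ((\<chi> i. u $ g i) - (\<chi> i. l $ g i) :: real ^ 'm) \<bullet> b)"
    by (subst emeasure_lborel_box) (auto simp: Basis_vec_def inner_axis le')
  also have "\<dots> = ennreal (\<Prod>i\<in>UNIV. u $ g i - l $ g i)"
    by (simp add: Basis_vec_def UNION_singleton_eq_range prod.reindex axis_eq_axis inj_on_def inner_axis)
  also have "(\<Prod>i\<in>UNIV. u $ g i - l $ g i) = (\<Prod>i\<in>UNIV. u $ i - l $ i)"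
    by (rule prod.reindex_bij_betw) (use g in auto)
  also have "\<dots> = (\<Prod>b\<in>Basis. (u - l) \<bullet> b)"
    by (simp add: Basis_vec_def UNION_singleton_eq_range prod.reindex axis_eq_axis inj_on_def inner_axis)
  finally show "emeasure (distr lborel borel ?f) (box l u) = (\<Prod>b\<in>Basis. (u - l) \<bullet> b)" .
qed simp

text \<open>
  The determinant formula for the content of a simplex holds over a well-ordered index type. The
  coordinates are relabelled by the well-ordered copy of \<^typ>\<open>'n\<close>; this changes neither the volume nor the
  determinant.
\<close>

theorem normalized_volume_simplex:
  fixes V :: "(real ^ 'n) set" and h :: "'n \<Rightarrow> real ^ 'n"
  assumes fin: "finite V" and card: "card V = CARD('n) + 1" and b: "b \<in> V"
    and h: "bij_betw h UNIV (V - {b})"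
  shows "normalized_volume (convex hull V) = \<bar>det (\<chi> i. h i - b)\<bar>"
proof -
  have "CARD('n idx) = CARD('n)" by (rule CARD_idx)
  then obtain g :: "'n idx \<Rightarrow> 'n" where g: "bij g"
    using finite_same_card_bij[of "UNIV :: 'n idx set" "UNIV :: 'n set"] by auto
  have inv: "inv_into UNIV g (g i) = i" "g (inv_into UNIV g j) = j" for i j
    using g by (auto simp: bij_is_inj bij_is_surj surj_f_inv_f)
  define f where "f x = (\<chi> i. x $ inv_into UNIV g i)" for x :: "real ^ 'n idx"
  define k where "k y = (\<chi> i. y $ g i)" for y :: "real ^ 'n"
  have kf: "k (f x) = x" and fk: "f (k y) = y" for x y
    by (simp_all add: f_def k_def vec_eq_iff inv)
  have lin: "linear k"
    by (rule linearI) (simp_all add: k_def vec_eq_iff)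
  have injk: "inj k"
    by (metis fk injI)
  have compact: "compact (convex hull V)"
    using fin by (rule finite_imp_compact_convex_hull)
  have pre: "f -` (convex hull V) = convex hull (k ` V)"
    by (subst convex_hull_linear_image[OF lin, symmetric]) (force simp: fk kf image_iff)
  have [measurable]: "f \<in> borel \<rightarrow>\<^sub>M borel"
    unfolding f_def by (intro borel_measurable_continuous_onI continuous_intros)
  have "measure lebesgue (convex hull V) = measure lborel (convex hull V)"
    using compact by (intro measure_completion) (auto dest: compact_imp_closed)
  also have "\<dots> = measure (distr lborel borel f) (convex hull V)"
    using lborel_relabel_coordinates[OF g] unfolding f_def by simp
  also have "\<dots> = measure lborel (convex hull (k ` V))"
    using compact by (subst measure_distr) (auto simp: pre dest: compact_imp_closed)
  also have "\<dots> = \<bar>det (\<chi> i j. k (h (g j)) $ i - k b $ i)\<bar> / fact CARD('n idx)"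
  proof (rule content_simplex)
    show "finite (k ` V)" "k b \<in> k ` V"
      using fin b by auto
    show "card (k ` V) = Suc CARD('n idx)"
      using card injk by (simp add: card_image inj_on_subset CARD_idx)
    show "bij_betw (\<lambda>j. k (h (g j))) UNIV (k ` V - {k b})"
    proof -
      have "bij_betw k (V - {b}) (k ` (V - {b}))"
        using inj_on_subset[OF injk] by (simp add: bij_betw_def)
      moreover have "k ` (V - {b}) = k ` V - {k b}"
        using injk by (auto simp: inj_def)
      ultimately have "bij_betw (k \<circ> (h \<circ> g)) UNIV (k ` V - {k b})"
        using bij_betw_trans[OF bij_betw_trans[OF g h]] by simp
      then show ?thesis by (simp add: o_def)
    qed
  qed
  also have "(\<chi> i j. k (h (g j)) $ i - k b $ i) =
      transpose (\<chi> i j. (\<chi> i. h i - b) $ g i $ g j)"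
    by (simp add: k_def transpose_def)
  also have "det \<dots> = det (\<chi> i. h i - b)"
    by (subst det_transpose) (rule det_reindex[OF g])
  finally show ?thesis
    by (simp add: normalized_volume_def CARD_idx)
qed

section \<open>Integral weights on lattice points\<close>

lemma int_points_0: "0 \<in> int_points"
  by (simp add: int_points_def)

lemma int_points_add: "x \<in> int_points \<Longrightarrow> y \<in> int_points \<Longrightarrow> x + y \<in> int_points"
  by (simp add: int_points_def)

lemma int_points_diff: "x \<in> int_points \<Longrightarrow> y \<in> int_points \<Longrightarrow> x - y \<in> int_points"
  by (simp add: int_points_def)

lemma int_points_scaleR: "c \<in> \<int> \<Longrightarrow> x \<in> int_points \<Longrightarrow> c *\<^sub>R x \<in> int_points"
  by (simp add: int_points_def)

lemma int_points_sum: "(\<And>i. i \<in> A \<Longrightarrow> f i \<in> int_points) \<Longrightarrow> sum f A \<in> int_points"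
  by (induction A rule: infinite_finite_induct) (auto simp: int_points_0 int_points_add)

lemma int_points_axis: "axis i 1 \<in> int_points"
  by (simp add: int_points_def axis_def)

lemma det_in_Ints:
  fixes A :: "real ^ 'n ^ 'n"
  assumes "\<And>i. row i A \<in> int_points"
  shows "det A \<in> \<int>"
proof -
  have "A $ i $ j \<in> \<int>" for i j
    using assms[of i] by (simp add: int_points_def row_def)
  then show ?thesis
    unfolding det_def by (intro Ints_sum Ints_mult Ints_prod) auto
qed

lemma inner_int_points:
  fixes x y :: "real ^ 'n"
  shows "x \<in> int_points \<Longrightarrow> y \<in> int_points \<Longrightarrow> x \<bullet> y \<in> \<int>"
  by (auto simp: int_points_def inner_vec_def)

text \<open>
  The preimage of \<open>simplex_group\<close> among real weights. Indexing by the vertices themselves keeps the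
  geometric part of the argument independent of the ordering of the vertices.
\<close>

definition weight_lattice :: "(real ^ 'n) set \<Rightarrow> (real ^ 'n \<Rightarrow> real) set" where
  "weight_lattice V = {l. (\<Sum>x\<in>V. l x *\<^sub>R x) \<in> int_points \<and> (\<Sum>x\<in>V. l x) \<in> \<int>}"

lemma weight_lattice_cong:assumes "\<And>x. x \<in> V \<Longrightarrow> k x = l x"
  shows "k \<in> weight_lattice V \<longleftrightarrow> l \<in> weight_lattice V"
proof -
  have "(\<Sum>x\<in>V. k x *\<^sub>R x) = (\<Sum>x\<in>V. l x *\<^sub>R x)" "sum k V = sum l V"
    using assms by (auto intro: sum.cong)
  then show ?thesis
    by (simp add: weight_lattice_def)
qed

lemma weight_lattice_add:
  "k \<in> weight_lattice V \<Longrightarrow> l \<in> weight_lattice V \<Longrightarrow> (\<lambda>x. k x + l x) \<in> weight_lattice V"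
  by (simp add: weight_lattice_def scaleR_add_left sum.distrib int_points_add)

lemma weight_lattice_scale:
  assumes "c \<in> \<int>" "l \<in> weight_lattice V"
  shows "(\<lambda>x. c * l x) \<in> weight_lattice V"
proof -
  have "(\<Sum>x\<in>V. (c * l x) *\<^sub>R x) = c *\<^sub>R (\<Sum>x\<in>V. l x *\<^sub>R x)"
    by (simp add: scaleR_sum_right)
  then show ?thesis
    using assms by (simp add: weight_lattice_def int_points_scaleR sum_distrib_left[symmetric])
qed

lemma weight_lattice_diff:
  assumes "k \<in> weight_lattice V" "l \<in> weight_lattice V"
  shows "(\<lambda>x. k x - l x) \<in> weight_lattice V"
  using weight_lattice_add[OF assms(1) weight_lattice_scale[OF _ assms(2), of "- 1"]] by simp

lemma weight_lattice_Ints: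
  assumes "V \<subseteq> int_points" "\<And>x. x \<in> V \<Longrightarrow> l x \<in> \<int>"
  shows "l \<in> weight_lattice V"
  using assms by (auto simp: weight_lattice_def intro!: int_points_sum int_points_scaleR Ints_sum)

lemma row_edge_matrix:
  fixes h :: "'n::finite \<Rightarrow> real ^ 'm"
  shows "row i (\<chi> i. h i - b) = h i - b"
  by (simp add: vec_eq_iff row_def)

lemma edge_matrix_rows_in_int_points:
  fixes h :: "'n \<Rightarrow> real ^ 'n"
  assumes "V \<subseteq> int_points" "b \<in> V" "bij_betw h UNIV (V - {b})"
  shows "row i (\<chi> i. h i - b) \<in> int_points"
proof -
  have "h i \<in> V"
    using assms(3) by (auto simp: bij_betw_def)
  then have "h i - b \<in> int_points"
    using assms(1,2) by (auto intro: int_points_diff)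
  then show ?thesis
    by (simp add: row_edge_matrix)
qed

text \<open>
  Modulo the integral total weight, the vertex \<open>b\<close> may be moved to the origin.
\<close>

lemma weighted_edges_in_int_points:
  fixes V :: "(real ^ 'n) set"
  assumes fin: "finite V" and int: "V \<subseteq> int_points" and b: "b \<in> V"
    and h: "bij_betw h UNIV (V - {b})" and l: "l \<in> weight_lattice V"
  shows "(\<Sum>i\<in>UNIV. l (h i) *\<^sub>R (h i - b)) \<in> int_points"
proof -
  have "(\<Sum>i\<in>UNIV. l (h i) *\<^sub>R (h i - b)) = (\<Sum>x\<in>V - {b}. l x *\<^sub>R (x - b))"
    by (rule sum.reindex_bij_betw[OF h])
  also have "\<dots> = (\<Sum>x\<in>V. l x *\<^sub>R (x - b))"
    using fin by (intro sum.mono_neutral_left) auto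
  also have "\<dots> = (\<Sum>x\<in>V. l x *\<^sub>R x) - (\<Sum>x\<in>V. l x) *\<^sub>R b"
    by (simp add: scaleR_diff_right sum_subtractf scaleR_sum_left)
  finally show ?thesis
    using l int b by (auto simp: weight_lattice_def intro!: int_points_diff int_points_scaleR)
qed

text \<open>
  Cramer's rule: replacing row \<open>k\<close> of the edge matrix by the combination of its rows with
  coefficients \<open>l\<close> multiplies the determinant by \<open>l (h k)\<close>, and the new row is integral because \<open>l\<close> is a
  weight.
\<close>

lemma det_mult_weights_in_Ints:
  fixes V :: "(real ^ 'n) set" and h :: "'n \<Rightarrow> real ^ 'n" and b :: "real ^ 'n"
  defines "A \<equiv> (\<chi> i. h i - b)"
  assumes V: "finite V" "V \<subseteq> int_points" "b \<in> V" "bij_betw h UNIV (V - {b})"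
    and l: "l \<in> weight_lattice V"
  shows "l (h k) * det A \<in> \<int>"
proof -
  have rows: "row i A \<in> int_points" for i
    unfolding A_def by (rule edge_matrix_rows_in_int_points[OF V(2-4)])
  let ?B = "(\<chi> i. if i = k then \<Sum>i\<in>UNIV. (\<chi> i. l (h i)) $ i *s row i A else row i A)"
  have "det ?B \<in> \<int>"
    using weighted_edges_in_int_points[OF V l] rows
    by (intro det_in_Ints) (simp add: row_def[of _ ?B] vec_lambda_eta scalar_mult_eq_scaleR A_def row_edge_matrix)
  then show ?thesis
    by (simp only: cramer_lemma_transpose) simp
qed

text \<open>
  Cramer's rule for two rows at once. The assumption that \<open>l\<close> vanishes at \<open>h i\<close> makes the
  \<open>2 \<times> 2\<close> minor of \<open>k\<close> and \<open>l\<close> a single product.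
\<close>

lemma det_mult_weight_pairs_in_Ints:
  fixes V :: "(real ^ 'n) set" and h :: "'n \<Rightarrow> real ^ 'n" and b :: "real ^ 'n"
  defines "A \<equiv> (\<chi> i. h i - b)"
  assumes V: "finite V" "V \<subseteq> int_points" "b \<in> V" "bij_betw h UNIV (V - {b})"
    and k: "k \<in> weight_lattice V" and l: "l \<in> weight_lattice V"
    and ij: "i \<noteq> j" and li: "l (h i) = 0"
  shows "k (h i) * l (h j) * det A \<in> \<int>"
proof -
  have rows: "row m A \<in> int_points" for m
    unfolding A_def by (rule edge_matrix_rows_in_int_points[OF V(2-4)])
  let ?k = "\<chi> i. k (h i)" and ?l = "\<chi> i. l (h i)"
  let ?B = "(\<chi> m. if m = i then \<Sum>i\<in>UNIV. ?k $ i *s row i A else row m A) :: real ^ 'n ^ 'n"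
  \<comment> \<open>Since \<open>l\<close> vanishes at \<open>h i\<close>, the change of row \<open>i\<close> does not affect the combination with coefficients \<open>l\<close>.\<close>
  let ?C = "(\<chi> m. if m = j then \<Sum>i\<in>UNIV. ?l $ i *s row i ?B else row m ?B) :: real ^ 'n ^ 'n"
  have rowA: "row m A = h m - b" for m
    by (simp add: A_def row_edge_matrix)
  have Bi: "row m ?B = (if m = i then \<Sum>i\<in>UNIV. ?k $ i *s row i A else row m A)" for m
    by (simp add: row_def vec_lambda_eta)
  have Bint: "row m ?B \<in> int_points" for m
    using weighted_edges_in_int_points[OF V k] rows
    by (simp add: Bi rowA scalar_mult_eq_scaleR)
  have "(\<Sum>m\<in>UNIV. ?l $ m *s row m ?B) = (\<Sum>m\<in>UNIV. l (h m) *\<^sub>R (h m - b))"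
    by (rule sum.cong[OF refl]) (auto simp: Bi li rowA scalar_mult_eq_scaleR)
  also have "\<dots> \<in> int_points"
    by (rule weighted_edges_in_int_points[OF V l])
  finally have "det ?C \<in> \<int>"
    using Bint by (intro det_in_Ints) (simp add: row_def[of _ ?C] vec_lambda_eta)
  also have "det ?C = l (h j) * (k (h i) * det A)"
    by (simp only: cramer_lemma_transpose) simp
  finally show ?thesis by (simp add: mult_ac)
qed

text \<open>
  The rows of the inverse edge matrix, completed by an entry at \<open>b\<close> that makes the total zero, are
  weights. If \<open>k\<close> kills all weights modulo the integers, then \<open>k\<close> times the inverse is an integral
  matrix, whose determinant is \<open>k ^ CARD('n)\<close> divided by that of the edge matrix.
\<close>

lemma det_dvd_exponent_power:
  fixes V :: "(real ^ 'n) set" and h :: "'n \<Rightarrow> real ^ 'n" and b :: "real ^ 'n"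
  defines "A \<equiv> (\<chi> i. h i - b)"
  assumes V: "finite V" "V \<subseteq> int_points" "b \<in> V" "bij_betw h UNIV (V - {b})"
    and det: "\<bar>det A\<bar> = real N" and N: "N > 0"
    and k: "\<And>l x. l \<in> weight_lattice V \<Longrightarrow> x \<in> V \<Longrightarrow> real k * l x \<in> \<int>"
  shows "N dvd k ^ CARD('n)"
proof -
  have "det A \<noteq> 0" using det N by auto
  then obtain B where AB: "A ** B = mat 1" and BA: "B ** A = mat 1"
    using invertible_det_nz[of A] by (auto simp: invertible_def)
  define C where "C = (\<chi> i. real k *\<^sub>R row i B)"
  have hinv: "inv_into UNIV h (h i) = i" and hV: "h i \<in> V" "h i \<noteq> b" for i
    using V(4) by (auto simp: bij_betw_def)
  have "row i C \<in> int_points" for i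
  proof -
    \<comment> \<open>Row \<open>i\<close> of the inverse, with the entry at \<open>b\<close> that makes the total zero; it represents the unit vector \<open>axis i 1\<close>.\<close>
    define l where "l x = (if x = b then - (\<Sum>j\<in>UNIV. B $ i $ j) else B $ i $ inv_into UNIV h x)" for x
    have lh: "l (h j) = B $ i $ j" for j
      by (simp add: l_def hV hinv)
    have split: "(\<Sum>x\<in>V. f x) = f b + (\<Sum>j\<in>UNIV. f (h j))" for f :: "_ \<Rightarrow> 'x::comm_monoid_add"
      using V by (simp add: sum.remove[of V b] sum.reindex_bij_betw[OF V(4), symmetric])
    have "(\<Sum>x\<in>V. l x *\<^sub>R x) = (\<Sum>j\<in>UNIV. B $ i $ j *\<^sub>R (h j - b))"
      by (simp add: split lh) (simp add: l_def scaleR_diff_right sum_subtractf scaleR_sum_left)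
    also have "\<dots> = row i (B ** A)"
      by (simp add: vec_eq_iff row_def matrix_matrix_mult_def A_def)
    also have "\<dots> = axis i 1"
      by (simp add: BA vec_eq_iff row_def mat_def axis_def)
    finally have "(\<Sum>x\<in>V. l x *\<^sub>R x) \<in> int_points"
      by (simp add: int_points_axis)
    moreover have "(\<Sum>x\<in>V. l x) = 0"
      by (simp add: split lh) (simp add: l_def)
    ultimately have "l \<in> weight_lattice V"
      by (simp add: weight_lattice_def)
    then have "real k * B $ i $ j \<in> \<int>" for j
      using k[of l "h j"] hV by (simp add: lh)
    then show ?thesis
      by (simp add: int_points_def C_def row_def)
  qed
  then have "det C \<in> \<int>" by (rule det_in_Ints)
  then obtain z where z: "det C = of_int z" by (elim Ints_cases)
  have "C = real k *\<^sub>R B"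
    by (simp add: C_def vec_eq_iff row_def)
  then have "det C = real k ^ CARD('n) * det B"
    using det_rows_mul[of "\<lambda>_. real k" "\<lambda>i. B $ i"]
    by (simp add: C_def row_def vec_lambda_eta scalar_mult_eq_scaleR)
  moreover have "det A * det B = 1"
    using AB det_mul[of A B] by simp
  ultimately have "of_int z * det A = real k ^ CARD('n)"
    using z by (metis mult.assoc mult.commute mult.right_neutral)
  then have "\<bar>of_int z\<bar> * real N = real k ^ CARD('n)"
    using det by (metis abs_mult abs_of_nat of_nat_power)
  then have "real (nat \<bar>z\<bar> * N) = real (k ^ CARD('n))"
    by simp
  then show ?thesis
    by (metis dvd_triv_right of_nat_eq_iff)
qed

section \<open>Facet functionals of a lattice simplex\<close>

locale full_simplex =
  fixes V :: "(real ^ 'n) set"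
  assumes affine_independent: "\<not> affine_dependent V"
    and card_V: "card V = CARD('n) + 1"
    and V_int: "V \<subseteq> int_points"
begin

lemma finite_V: "finite V"
  using affine_independent aff_independent_finite by blast

lemma ex_other: obtains b where "b \<in> V" "b \<noteq> x"
proof -
  have "\<not> V \<subseteq> {x}"
  proof
    assume "V \<subseteq> {x}"
    then have "card V \<le> 1"
      using card_mono[of "{x}" V] by simp
    then show False
      by (simp add: card_V)
  qed
  then show ?thesis using that by blast
qed

lemma affine_hull_V: "affine hull V = UNIV"
proof -
  have "aff_dim V = int (card V) - 1"
    using aff_dim_affine_independent[OF affine_independent] by simp
  then have "aff_dim V = int DIM(real ^ 'n)"
    by (simp add: card_V)
  then show ?thesis
    using aff_dim_eq_full by blast
qed

text \<open>
  The edges at a vertex \<open>b\<close> other than \<open>x\<close> are linearly independent, so a linear form may be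
  prescribed on them.
\<close>

lemma vertex_functional_exists:
  assumes x: "x \<in> V"
  shows "\<exists>u c. \<forall>y\<in>V. y \<bullet> u + c = (if y = x then 1 else 0)"
proof -
  obtain b where b: "b \<in> V" "b \<noteq> x" by (rule ex_other)
  have "independent ((\<lambda>y. - b + y) ` (V - {b}))"
    using affine_independent affine_dependent_iff_dependent2[OF b(1)] by simp
  then obtain g :: "real ^ 'n \<Rightarrow> real" where g: "linear g"
    "\<forall>z\<in>(\<lambda>y. - b + y) ` (V - {b}). g z = (if z = - b + x then 1 else 0)"
    using linear_independent_extend[of _ "\<lambda>z. if z = - b + x then 1 else 0"] by blast
  have gz: "g z = z \<bullet> adjoint g 1" for z
    using adjoint_works[OF g(1), of z 1] by simp
  have "y \<bullet> adjoint g 1 + - (b \<bullet> adjoint g 1) = (if y = x then 1 else 0)" if "y \<in> V" for y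
  proof (cases "y = b")
    case True
    then show ?thesis using b by simp
  next
    case False
    have "y \<bullet> adjoint g 1 + - (b \<bullet> adjoint g 1) = g (- b + y)"
      by (simp add: gz inner_diff_left)
    also have "\<dots> = (if y = x then 1 else 0)"
      using g(2) that False by simp
    finally show ?thesis .
  qed
  then show ?thesis by blast
qed

definition facet_normal :: "real ^ 'n \<Rightarrow> real ^ 'n" where
  "facet_normal x = (SOME u. \<exists>c. \<forall>y\<in>V. y \<bullet> u + c = (if y = x then 1 else 0))"

definition facet_offset :: "real ^ 'n \<Rightarrow> real" where
  "facet_offset x = (SOME c. \<forall>y\<in>V. y \<bullet> facet_normal x + c = (if y = x then 1 else 0))"

text \<open>
  The barycentric coordinate at \<open>x\<close> of a point \<open>z\<close> of degree \<open>t\<close>, homogeneous in \<open>(z, t)\<close>: the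
  coordinates express \<open>(z, t)\<close> through the vectors \<open>(y, 1)\<close> for vertices \<open>y\<close>.
\<close>

definition bary :: "real ^ 'n \<Rightarrow> real \<Rightarrow> real ^ 'n \<Rightarrow> real" where
  "bary z t x = z \<bullet> facet_normal x + t * facet_offset x"

lemma bary_vertex:
  assumes "x \<in> V" "y \<in> V"
  shows "bary y 1 x = (if y = x then 1 else 0)"
proof -
  have "\<exists>c. \<forall>y\<in>V. y \<bullet> facet_normal x + c = (if y = x then 1 else 0)"
    unfolding facet_normal_def using someI_ex[OF vertex_functional_exists[OF assms(1)]] .
  then have "\<forall>y\<in>V. y \<bullet> facet_normal x + facet_offset x = (if y = x then 1 else 0)"
    unfolding facet_offset_def by (rule someI_ex)
  then show ?thesis
    using assms by (simp add: bary_def)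
qed

lemma bary_combination:
  assumes "x \<in> V"
  shows "bary (\<Sum>y\<in>V. l y *\<^sub>R y) (\<Sum>y\<in>V. l y) x = l x"
proof -
  have "bary (\<Sum>y\<in>V. l y *\<^sub>R y) (\<Sum>y\<in>V. l y) x = (\<Sum>y\<in>V. l y * bary y 1 x)"
    by (simp add: bary_def inner_sum_left sum_distrib_right sum.distrib distrib_left)
  also have "\<dots> = (\<Sum>y\<in>V. if y = x then l y else 0)"
    using assms by (intro sum.cong) (auto simp: bary_vertex)
  finally show ?thesis
    using finite_V assms by simp
qed

text \<open>
  Every point is an affine combination of the vertices, with coefficients \<open>bary z 1\<close>. The general
  degree follows since \<open>bary z t\<close> is affine in \<open>t\<close>.
\<close>

lemma bary_expansion: "(\<Sum>x\<in>V. bary z t x *\<^sub>R x) = z" "(\<Sum>x\<in>V. bary z t x) = t"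
proof -
  have one: "(\<Sum>x\<in>V. bary z 1 x *\<^sub>R x) = z \<and> (\<Sum>x\<in>V. bary z 1 x) = 1" for z
  proof -
    have "z \<in> affine hull V" by (simp add: affine_hull_V)
    then obtain l where l: "sum l V = 1" "(\<Sum>x\<in>V. l x *\<^sub>R x) = z"
      using finite_V by (auto simp: affine_hull_finite)
    have "bary z 1 x = l x" if "x \<in> V" for x
      using bary_combination[OF that, of l] l by simp
    then show ?thesis using l by simp
  qed
  have eq: "bary z t x = bary z 1 x + (t - 1) * bary 0 1 x" for x
    by (simp add: bary_def algebra_simps)
  have "(\<Sum>x\<in>V. bary z t x *\<^sub>R x) =
      (\<Sum>x\<in>V. bary z 1 x *\<^sub>R x) + (t - 1) *\<^sub>R (\<Sum>x\<in>V. bary 0 1 x *\<^sub>R x)"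
    by (simp add: eq scaleR_add_left sum.distrib scaleR_sum_right)
  then show "(\<Sum>x\<in>V. bary z t x *\<^sub>R x) = z"
    using one[of z] one[of 0] by simp
  have "(\<Sum>x\<in>V. bary z t x) = (\<Sum>x\<in>V. bary z 1 x) + (t - 1) * (\<Sum>x\<in>V. bary 0 1 x)"
    by (simp add: eq sum.distrib sum_distrib_left)
  then show "(\<Sum>x\<in>V. bary z t x) = t"
    using one[of z] one[of 0] by simp
qed

lemma bary_in_weight_lattice:
  assumes "z \<in> int_points" "t \<in> \<int>"
  shows "bary z t \<in> weight_lattice V"
  using assms by (simp add: weight_lattice_def bary_expansion)

lemma weight_lattice_eq_bary:
  assumes "l \<in> weight_lattice V"
  obtains z t where "z \<in> int_points" "t \<in> \<int>" "\<And>x. x \<in> V \<Longrightarrow> l x = bary z t x"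
proof
  show "(\<Sum>x\<in>V. l x *\<^sub>R x) \<in> int_points" "(\<Sum>x\<in>V. l x) \<in> \<int>"
    using assms by (auto simp: weight_lattice_def)
qed (simp add: bary_combination)

text \<open>
  The transpose of \<open>bary_expansion\<close>: the vertices and the facet normals are dual frames.
\<close>

lemma facet_normal_expansion: "(\<Sum>x\<in>V. (x \<bullet> y) *\<^sub>R facet_normal x) = y"
proof -
  have "z \<bullet> (\<Sum>x\<in>V. (x \<bullet> y) *\<^sub>R facet_normal x) = (\<Sum>x\<in>V. bary z 0 x *\<^sub>R x) \<bullet> y" for z
    by (simp add: inner_sum_left inner_sum_right bary_def mult_ac)
  then have "\<forall>z. z \<bullet> (\<Sum>x\<in>V. (x \<bullet> y) *\<^sub>R facet_normal x) = z \<bullet> y"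
    by (simp add: bary_expansion)
  then show ?thesis
    by (simp only: vector_eq_ldot)
qed

lemma facet_normal_sum: "(\<Sum>x\<in>V. facet_normal x) = 0"
proof -
  have "z \<bullet> (\<Sum>x\<in>V. facet_normal x) = 0" for z
    using bary_expansion(2)[of z 0] by (simp add: inner_sum_right bary_def)
  then show ?thesis
    by (metis inner_eq_zero_iff)
qed

lemma facet_normal_nonzero: "x \<in> V \<Longrightarrow> facet_normal x \<noteq> 0"
proof
  assume x: "x \<in> V" "facet_normal x = 0"
  obtain b where "b \<in> V" "b \<noteq> x" by (rule ex_other)
  then show False
    using bary_vertex[of x b] bary_vertex[of x x] x by (simp add: bary_def)
qed

lemma mem_hull_iff: "z \<in> convex hull V \<longleftrightarrow> (\<forall>x\<in>V. bary z 1 x \<ge> 0)"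
proof
  assume "z \<in> convex hull V"
  then obtain l where l: "\<forall>x\<in>V. 0 \<le> l x" "sum l V = 1" "(\<Sum>x\<in>V. l x *\<^sub>R x) = z"
    using finite_V by (auto simp: convex_hull_finite)
  have "bary z 1 x = l x" if "x \<in> V" for x
    using bary_combination[OF that, of l] l by simp
  then show "\<forall>x\<in>V. bary z 1 x \<ge> 0" using l by simp
next
  assume "\<forall>x\<in>V. bary z 1 x \<ge> 0"
  then show "z \<in> convex hull V"
    using finite_V bary_expansion[of z 1]
    by (auto simp: convex_hull_finite intro!: exI[of _ "bary z 1"])
qed

lemma vertices_hull: "vertices (convex hull V) = V"
  unfolding vertices_def
  using extreme_point_of_convex_hull_affine_independent[OF affine_independent] by auto

end

section \<open>Reflexive dilations and the Gorenstein property\<close>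

locale dilated_simplex = full_simplex V for V :: "(real ^ 'n) set" +
  fixes r :: nat and w :: "real ^ 'n"
  assumes r_pos: "r > 0" and w_int: "w \<in> int_points"
begin

definition dilate :: "(real ^ 'n) set" where
  "dilate = (\<lambda>x. real r *\<^sub>R x + w) ` (convex hull V)"

text \<open>
  The barycentric coordinates of the origin with respect to the dilate, scaled to have total \<open>r\<close>.
\<close>

definition origin_weight :: "real ^ 'n \<Rightarrow> real" where
  "origin_weight x = bary (- w) (real r) x"

lemma bary_dilated: "bary (real r *\<^sub>R z + w) 0 x = real r * bary z 1 x - origin_weight x"
  using r_pos by (simp add: origin_weight_def bary_def inner_add_left algebra_simps)

lemma mem_dilate_iff: "y \<in> dilate \<longleftrightarrow> (\<forall>x\<in>V. - origin_weight x \<le> y \<bullet> facet_normal x)"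
proof -
  define z where "z = (1 / real r) *\<^sub>R (y - w)"
  have y: "y = real r *\<^sub>R z + w"
    using r_pos by (simp add: z_def)
  have "y \<in> dilate \<longleftrightarrow> z \<in> convex hull V"
    using r_pos by (auto simp: dilate_def y)
  also have "\<dots> \<longleftrightarrow> (\<forall>x\<in>V. - origin_weight x \<le> bary y 0 x)"
    using r_pos by (simp add: mem_hull_iff y bary_dilated zero_le_mult_iff)
  finally show ?thesis
    by (simp add: bary_def)
qed

lemma dilate_eq_hull: "dilate = convex hull ((\<lambda>x. real r *\<^sub>R x + w) ` V)"
proof -
  have "dilate = (+) w ` ((*\<^sub>R) (real r) ` (convex hull V))"
    by (simp add: dilate_def image_image add.commute)
  also have "\<dots> = convex hull ((+) w ` ((*\<^sub>R) (real r) ` V))"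
    by (simp only: convex_hull_scaling[symmetric] convex_hull_translation[symmetric])
  finally show ?thesis
    by (simp add: image_image add.commute)
qed

lemma lattice_polytope_dilate: "lattice_polytope dilate"
proof -
  have "vertices dilate \<subseteq> (\<lambda>x. real r *\<^sub>R x + w) ` V"
    unfolding vertices_def dilate_eq_hull using extreme_point_of_convex_hull by blast
  also have "\<dots> \<subseteq> int_points"
    using V_int w_int by (auto intro!: int_points_add int_points_scaleR)
  finally show ?thesis
    using finite_V by (auto simp: lattice_polytope_def polytope_def dilate_eq_hull)
qed

lemma full_dim_dilate: "full_dim dilate"
proof -
  have "dilate = (+) w ` ((*\<^sub>R) (real r) ` (convex hull V))"
    by (simp add: dilate_def image_image add.commute)
  then have "aff_dim dilate = aff_dim ((*\<^sub>R) (real r) ` (convex hull V))"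
    by (simp add: aff_dim_translation_eq)
  also have "\<dots> = aff_dim (convex hull V)"
    using r_pos by (intro aff_dim_injective_linear_image) (auto simp: inj_on_def linear_iff scaleR_add_right)
  also have "\<dots> = int CARD('n)"
    using aff_dim_affine_independent[OF affine_independent] card_V by (simp add: aff_dim_convex_hull)
  finally show ?thesis by (simp add: full_dim_def)
qed

lemma interior_dilate: "interior dilate = {y. \<forall>x\<in>V. - origin_weight x < y \<bullet> facet_normal x}"
proof -
  have interior_INT: "interior (\<Inter>x\<in>A. f x) = (\<Inter>x\<in>A. interior (f x))"
    if "finite A" for A :: "(real ^ 'n) set" and f :: "real ^ 'n \<Rightarrow> (real ^ 'n) set"
    using that by induction auto
  have "dilate = (\<Inter>x\<in>V. {y. facet_normal x \<bullet> y \<ge> - origin_weight x})"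
    by (auto simp: mem_dilate_iff inner_commute)
  then have "interior dilate = (\<Inter>x\<in>V. interior {y. facet_normal x \<bullet> y \<ge> - origin_weight x})"
    using finite_V by (simp add: interior_INT)
  also have "\<dots> = (\<Inter>x\<in>V. {y. facet_normal x \<bullet> y > - origin_weight x})"
    using facet_normal_nonzero by (intro INF_cong) (auto simp: interior_halfspace_ge)
  finally show ?thesis by (auto simp: inner_commute)
qed

lemma zero_in_interior_iff: "0 \<in> interior dilate \<longleftrightarrow> (\<forall>x\<in>V. origin_weight x > 0)"
  by (auto simp: interior_dilate)

lemma origin_weight_sum: "(\<Sum>x\<in>V. origin_weight x *\<^sub>R x) = - w" "(\<Sum>x\<in>V. origin_weight x) = real r"
  by (simp_all add: origin_weight_def[abs_def] bary_expansion)

lemma origin_weight_in_weight_lattice: "origin_weight \<in> weight_lattice V"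
  using w_int by (auto simp: origin_weight_def[abs_def] int_points_def intro!: bary_in_weight_lattice)

definition dual_vertex :: "real ^ 'n \<Rightarrow> real ^ 'n" where
  "dual_vertex x = - (1 / origin_weight x) *\<^sub>R facet_normal x"

lemma mem_dual_iff: "y \<in> dual_polytope dilate \<longleftrightarrow> (\<forall>x\<in>V. (real r *\<^sub>R x + w) \<bullet> y \<le> 1)"
proof
  assume "y \<in> dual_polytope dilate"
  then show "\<forall>x\<in>V. (real r *\<^sub>R x + w) \<bullet> y \<le> 1"
    by (auto simp: dual_polytope_def dilate_def hull_inc)
next
  assume "\<forall>x\<in>V. (real r *\<^sub>R x + w) \<bullet> y \<le> 1"
  then have "(\<lambda>x. real r *\<^sub>R x + w) ` V \<subseteq> {z. y \<bullet> z \<le> 1}"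
    by (auto simp: inner_commute)
  then have "dilate \<subseteq> {z. y \<bullet> z \<le> 1}"
    unfolding dilate_eq_hull by (rule hull_minimal) (rule convex_halfspace_le)
  then show "y \<in> dual_polytope dilate"
    by (auto simp: dual_polytope_def inner_commute)
qed

lemma vertex_dual_vertex:
  assumes "x \<in> V" "y \<in> V" "origin_weight x > 0"
  shows "(real r *\<^sub>R y + w) \<bullet> dual_vertex x = 1 - (if y = x then real r / origin_weight x else 0)"
proof -
  have "(real r *\<^sub>R y + w) \<bullet> dual_vertex x = - (1 / origin_weight x) * bary (real r *\<^sub>R y + w) 0 x"
    by (simp add: dual_vertex_def bary_def)
  also have "\<dots> = 1 - (if y = x then real r / origin_weight x else 0)"
    unfolding bary_dilated using assms by (simp add: bary_vertex right_diff_distrib)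
  finally show ?thesis .
qed

text \<open>
  The coefficient of \<open>dual_vertex x\<close> is, up to a positive factor, the slack of \<open>y\<close> in the inequality
  that \<open>x\<close> defines on the dual polytope, so that these are the barycentric coordinates of \<open>y\<close> in the dual
  simplex.
\<close>

lemma dual_expansion:
  assumes pos: "\<And>x. x \<in> V \<Longrightarrow> origin_weight x > 0"
  shows "(\<Sum>x\<in>V. ((1 - (real r *\<^sub>R x + w) \<bullet> y) * origin_weight x / real r) *\<^sub>R dual_vertex x) = y"
    and "(\<Sum>x\<in>V. (1 - (real r *\<^sub>R x + w) \<bullet> y) * origin_weight x / real r) = 1"
proof -
  have "(\<Sum>x\<in>V. ((1 - (real r *\<^sub>R x + w) \<bullet> y) * origin_weight x / real r) *\<^sub>R dual_vertex x)
      = (\<Sum>x\<in>V. ((x \<bullet> y) *\<^sub>R facet_normal x - ((1 - w \<bullet> y) / real r) *\<^sub>R facet_normal x))"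
  proof (rule sum.cong[OF refl])
    fix x assume "x \<in> V"
    then have "origin_weight x > 0" by (rule pos)
    then have "(1 - (real r *\<^sub>R x + w) \<bullet> y) * origin_weight x / real r * (- (1 / origin_weight x)) =
        x \<bullet> y - (1 - w \<bullet> y) / real r"
      using r_pos by (simp add: inner_add_left field_simps)
    then show "((1 - (real r *\<^sub>R x + w) \<bullet> y) * origin_weight x / real r) *\<^sub>R dual_vertex x =
        (x \<bullet> y) *\<^sub>R facet_normal x - ((1 - w \<bullet> y) / real r) *\<^sub>R facet_normal x"
      unfolding dual_vertex_def scaleR_scaleR scaleR_left_diff_distrib[symmetric] by simp
  qed
  also have "\<dots> = (\<Sum>x\<in>V. (x \<bullet> y) *\<^sub>R facet_normal x) - ((1 - w \<bullet> y) / real r) *\<^sub>R (\<Sum>x\<in>V. facet_normal x)"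
    by (simp only: sum_subtractf scaleR_sum_right)
  also have "\<dots> = y"
    by (simp add: facet_normal_expansion facet_normal_sum)
  finally show "(\<Sum>x\<in>V. ((1 - (real r *\<^sub>R x + w) \<bullet> y) * origin_weight x / real r) *\<^sub>R dual_vertex x) = y" .
  have "(\<Sum>x\<in>V. (1 - (real r *\<^sub>R x + w) \<bullet> y) * origin_weight x) =
      (\<Sum>x\<in>V. origin_weight x) - real r * ((\<Sum>x\<in>V. origin_weight x *\<^sub>R x) \<bullet> y) - (\<Sum>x\<in>V. origin_weight x) * (w \<bullet> y)"
    by (simp add: inner_sum_left inner_add_left sum_distrib_left sum_distrib_right
        algebra_simps sum.distrib sum_subtractf)
  also have "\<dots> = real r"
    by (simp add: origin_weight_sum)
  finally show "(\<Sum>x\<in>V. (1 - (real r *\<^sub>R x + w) \<bullet> y) * origin_weight x / real r) = 1"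
    using r_pos by (simp flip: sum_divide_distrib)
qed

lemma dual_eq_hull:
  assumes pos: "\<And>x. x \<in> V \<Longrightarrow> origin_weight x > 0"
  shows "dual_polytope dilate = convex hull (dual_vertex ` V)"
proof
  show "dual_polytope dilate \<subseteq> convex hull (dual_vertex ` V)"
  proof
    fix y assume y: "y \<in> dual_polytope dilate"
    have "(\<Sum>x\<in>V. ((1 - (real r *\<^sub>R x + w) \<bullet> y) * origin_weight x / real r) *\<^sub>R dual_vertex x)
        \<in> convex hull (dual_vertex ` V)"
      using y pos r_pos dual_expansion(2)[OF pos, of y] finite_V
      by (intro convex_sum) (auto simp: mem_dual_iff less_imp_le intro!: hull_inc mult_nonneg_nonneg divide_nonneg_nonneg)
    then show "y \<in> convex hull (dual_vertex ` V)"
      by (simp add: dual_expansion(1)[OF pos])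
  qed
  have "convex (dual_polytope dilate)"
  proof -
    have "dual_polytope dilate = (\<Inter>x\<in>dilate. {y. x \<bullet> y \<le> 1})"
      by (auto simp: dual_polytope_def)
    then show ?thesis
      by (simp add: convex_INT convex_halfspace_le)
  qed
  moreover have "dual_vertex ` V \<subseteq> dual_polytope dilate"
    using pos r_pos by (auto simp: mem_dual_iff vertex_dual_vertex less_imp_le)
  ultimately show "convex hull (dual_vertex ` V) \<subseteq> dual_polytope dilate"
    by (simp add: hull_minimal)
qed

text \<open>
  All inequalities except that of \<open>x\<close> are tight at \<open>dual_vertex x\<close>, so they are tight at the ends of any
  segment through it, and by \<open>dual_expansion\<close> no other point makes all of them tight.
\<close>

lemma dual_vertex_extreme:
  assumes pos: "\<And>x. x \<in> V \<Longrightarrow> origin_weight x > 0" and x: "x \<in> V"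
  shows "dual_vertex x extreme_point_of dual_polytope dilate"
  unfolding extreme_point_of_def
proof (intro conjI ballI notI)
  show "dual_vertex x \<in> dual_polytope dilate"
    using x by (simp add: dual_eq_hull[OF pos] hull_inc)
  fix a b assume ab: "a \<in> dual_polytope dilate" "b \<in> dual_polytope dilate" "dual_vertex x \<in> open_segment a b"
  then obtain t where t: "0 < t" "t < 1" "dual_vertex x = (1 - t) *\<^sub>R a + t *\<^sub>R b" and "a \<noteq> b"
    by (auto simp: in_segment)
  have tight: "(real r *\<^sub>R y + w) \<bullet> a = 1 \<and> (real r *\<^sub>R y + w) \<bullet> b = 1" if "y \<in> V" "y \<noteq> x" for y
  proof -
    let ?a = "(real r *\<^sub>R y + w) \<bullet> a" and ?b = "(real r *\<^sub>R y + w) \<bullet> b"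
    have "(1 - t) * ?a + t * ?b = 1"
      using vertex_dual_vertex[of x y] that x pos by (simp add: t(3) inner_add_right)
    moreover have "?a \<le> 1" "?b \<le> 1"
      using ab that by (auto simp: mem_dual_iff)
    ultimately have "(1 - t) * (1 - ?a) + t * (1 - ?b) = 0" "1 - ?a \<ge> 0" "1 - ?b \<ge> 0"
      by (simp_all add: algebra_simps)
    then show ?thesis
      using t by (simp add: add_nonneg_eq_0_iff)
  qed
  have "c = dual_vertex x" if c: "\<And>y. y \<in> V \<Longrightarrow> y \<noteq> x \<Longrightarrow> (real r *\<^sub>R y + w) \<bullet> c = 1" for c
  proof -
    let ?m = "\<lambda>y. (1 - (real r *\<^sub>R y + w) \<bullet> c) * origin_weight y / real r"
    have m0: "?m y = 0" if "y \<in> V - {x}" for y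
      using c that by simp
    have "?m x = 1"
      using dual_expansion(2)[OF pos, of c] sum.remove[OF finite_V x, of ?m] m0 by simp
    moreover have "?m x *\<^sub>R dual_vertex x = c"
      using dual_expansion(1)[OF pos, of c] sum.remove[OF finite_V x, of "\<lambda>y. ?m y *\<^sub>R dual_vertex y"] m0 by simp
    ultimately show ?thesis by simp
  qed
  then have "a = dual_vertex x" "b = dual_vertex x"
    using tight by blast+
  with \<open>a \<noteq> b\<close> show False by simp
qed


text \<open>
  A weight at \<open>x\<close> is the value of an affine functional at an integral point. Its linear part is
  \<open>origin_weight x\<close> times the negative of \<open>dual_vertex x\<close>; its constant term is minus the value of the linear part at
  any other vertex, since the functional vanishes there.
\<close>

lemma weight_div_origin_weight_in_Ints:
  assumes dual: "\<And>x. x \<in> V \<Longrightarrow> dual_vertex x \<in> int_points"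
    and l: "l \<in> weight_lattice V" and x: "x \<in> V"
  shows "l x / origin_weight x \<in> \<int>"
proof -
  obtain z t where z: "z \<in> int_points" and t: "t \<in> \<int>" and lx: "l x = bary z t x"
    using weight_lattice_eq_bary[OF l] x by metis
  obtain b where b: "b \<in> V" "b \<noteq> x" by (rule ex_other)
  have fn: "y \<bullet> facet_normal x / origin_weight x = - (y \<bullet> dual_vertex x)" for y
    by (simp add: dual_vertex_def)
  have "facet_offset x = - (b \<bullet> facet_normal x)"
    using bary_vertex[OF x b(1)] b(2) by (simp add: bary_def)
  then have "l x / origin_weight x = z \<bullet> facet_normal x / origin_weight x - t * (b \<bullet> facet_normal x / origin_weight x)"
    by (simp add: lx bary_def diff_divide_distrib)
  then have "l x / origin_weight x = t * (b \<bullet> dual_vertex x) - z \<bullet> dual_vertex x"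
    by (simp only: fn)
  moreover have "b \<in> int_points" using b V_int by blast
  ultimately show ?thesis
    using z t dual[OF x] by (simp add: inner_int_points)
qed

text \<open>
  Integral dual vertices also force the origin to be the only interior lattice point: at such a
  point every facet functional is an integer above \<open>-1\<close>, up to a positive factor, hence nonnegative, while the functionals sum to
  zero.
\<close>

lemma reflexive_iff:
  "reflexive dilate \<longleftrightarrow> (\<forall>x\<in>V. origin_weight x > 0 \<and> dual_vertex x \<in> int_points)"
proof
  assume dilate: "reflexive dilate"
  then have "0 \<in> interior dilate"
    by (auto simp: reflexive_def)
  then have pos: "origin_weight x > 0" if "x \<in> V" for x
    using that by (simp add: zero_in_interior_iff)
  have "dual_vertex x \<in> int_points" if "x \<in> V" for x
    using dual_vertex_extreme[OF pos that] dilate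
    by (auto simp: reflexive_def lattice_polytope_def vertices_def)
  with pos show "\<forall>x\<in>V. origin_weight x > 0 \<and> dual_vertex x \<in> int_points"
    by blast
next
  assume R: "\<forall>x\<in>V. origin_weight x > 0 \<and> dual_vertex x \<in> int_points"
  then have pos: "\<And>x. x \<in> V \<Longrightarrow> origin_weight x > 0" by blast
  have hull: "dual_polytope dilate = convex hull (dual_vertex ` V)"
    using pos by (rule dual_eq_hull)
  have "vertices (dual_polytope dilate) \<subseteq> dual_vertex ` V"
    unfolding vertices_def hull using extreme_point_of_convex_hull by blast
  then have "lattice_polytope (dual_polytope dilate)"
    using R finite_V by (auto simp: lattice_polytope_def polytope_def hull)
  moreover have "y = 0" if y: "y \<in> interior dilate" "y \<in> int_points" for y
  proof -
    have ge: "y \<bullet> facet_normal x \<ge> 0" if x: "x \<in> V" for x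
    proof -
      have "- origin_weight x < y \<bullet> facet_normal x"
        using y x by (simp add: interior_dilate)
      then have "y \<bullet> dual_vertex x < 1"
        using pos[OF x] by (simp add: dual_vertex_def field_simps)
      moreover have "y \<bullet> dual_vertex x \<in> \<int>"
        using y R x by (simp add: inner_int_points)
      ultimately have "y \<bullet> dual_vertex x \<le> 0"
        by (auto elim!: Ints_cases)
      then show ?thesis
        using pos[OF x] by (simp add: dual_vertex_def zero_le_divide_iff)
    qed
    have "(\<Sum>x\<in>V. y \<bullet> facet_normal x) = 0"
      by (simp add: inner_sum_right[symmetric] facet_normal_sum)
    then have "y \<bullet> facet_normal x = 0" if "x \<in> V" for x
      using sum_nonneg_eq_0_iff[OF finite_V ge] that by simp
    then show "y = 0"
      using bary_expansion(1)[of y 0] by (simp add: bary_def)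
  qed
  moreover have "0 \<in> interior dilate"
    using pos by (simp add: zero_in_interior_iff)
  ultimately show "reflexive dilate"
    using lattice_polytope_dilate full_dim_dilate int_points_0 by (auto simp: reflexive_def)
qed

end

context full_simplex
begin

lemma lattice_polytope_hull: "lattice_polytope (convex hull V)"
  using finite_V V_int by (auto simp: lattice_polytope_def polytope_def vertices_hull)

lemma full_dim_hull: "full_dim (convex hull V)"
  using aff_dim_affine_independent[OF affine_independent] card_V
  by (simp add: full_dim_def aff_dim_convex_hull)

text \<open>
  The weight \<open>1 / m\<close> consists of the barycentric coordinates of an interior lattice point of the dilate by
  \<open>r\<close>. The last condition says that every facet has lattice distance one from this point.
\<close>

theorem gorenstein_iff_weights:
  assumes r: "r > 0"
  shows "gorenstein r (convex hull V) \<longleftrightarrow>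
    (\<exists>m :: real ^ 'n \<Rightarrow> nat. (\<forall>x\<in>V. m x > (0 :: nat)) \<and> (\<lambda>x. 1 / m x) \<in> weight_lattice V \<and>
       (\<Sum>x\<in>V. 1 / m x) = real r \<and> (\<forall>l\<in>weight_lattice V. \<forall>x\<in>V. m x * l x \<in> \<int>))"
proof
  assume "gorenstein r (convex hull V)"
  then obtain w where w: "w \<in> int_points"
    and refl: "reflexive ((\<lambda>x. real r *\<^sub>R x + w) ` (convex hull V))"
    by (auto simp: gorenstein_def)
  interpret dilated_simplex V r w
    using r w by unfold_locales
  have pos: "origin_weight x > 0" and dual: "dual_vertex x \<in> int_points" if "x \<in> V" for x
    using refl that reflexive_iff by (auto simp: dilate_def)
  define m where "m x = nat \<lfloor>1 / origin_weight x\<rfloor>" for x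
  have m: "real (m x) = 1 / origin_weight x" if x: "x \<in> V" for x
  proof -
    have "(\<lambda>y. if y = x then 1 else 0) \<in> weight_lattice V"
      using V_int by (rule weight_lattice_Ints) auto
    from weight_div_origin_weight_in_Ints[OF dual this x] have "1 / origin_weight x \<in> \<int>"
      by simp
    then show ?thesis
      using pos[OF x] by (auto simp: m_def elim!: Ints_cases)
  qed
  have h: "1 / real (m x) = origin_weight x" if "x \<in> V" for x
    using m[OF that] by simp
  have "(\<lambda>x. 1 / m x) \<in> weight_lattice V"
    using weight_lattice_cong[of V "\<lambda>x. 1 / m x" origin_weight] h origin_weight_in_weight_lattice by simp
  moreover have "(\<Sum>x\<in>V. 1 / m x) = real r"
    using h by (simp add: origin_weight_sum)
  moreover have "\<forall>x\<in>V. m x > 0"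
  proof
    fix x assume "x \<in> V"
    then have "real (m x) > 0" using m pos by simp
    then show "m x > 0" by simp
  qed
  moreover have "\<forall>l\<in>weight_lattice V. \<forall>x\<in>V. m x * l x \<in> \<int>"
  proof (intro ballI)
    fix l x assume "l \<in> weight_lattice V" "x \<in> V"
    then have "l x / origin_weight x \<in> \<int>"
      using dual by (intro weight_div_origin_weight_in_Ints)
    then show "m x * l x \<in> \<int>"
      using m[OF \<open>x \<in> V\<close>] by simp
  qed
  ultimately show "\<exists>m :: real ^ 'n \<Rightarrow> nat. (\<forall>x\<in>V. m x > (0 :: nat)) \<and> (\<lambda>x. 1 / m x) \<in> weight_lattice V \<and>
       (\<Sum>x\<in>V. 1 / m x) = real r \<and> (\<forall>l\<in>weight_lattice V. \<forall>x\<in>V. m x * l x \<in> \<int>)"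
    by (intro exI[of _ m] conjI)
next
  assume "\<exists>m :: real ^ 'n \<Rightarrow> nat. (\<forall>x\<in>V. m x > (0 :: nat)) \<and> (\<lambda>x. 1 / m x) \<in> weight_lattice V \<and>
       (\<Sum>x\<in>V. 1 / m x) = real r \<and> (\<forall>l\<in>weight_lattice V. \<forall>x\<in>V. m x * l x \<in> \<int>)"
  then obtain m :: "real ^ 'n \<Rightarrow> nat" where m: "\<forall>x\<in>V. m x > 0"
    and mL: "(\<lambda>x. 1 / m x) \<in> weight_lattice V" and mr: "(\<Sum>x\<in>V. 1 / m x) = real r"
    and mint: "\<forall>l\<in>weight_lattice V. \<forall>x\<in>V. m x * l x \<in> \<int>"
    by (elim exE conjE)
  \<comment> \<open>The translation for which the point with coordinates \<open>1 / m\<close> becomes the origin.\<close>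
  define w where "w = (- 1) *\<^sub>R (\<Sum>x\<in>V. (1 / m x) *\<^sub>R x)"
  have w: "w \<in> int_points"
    unfolding w_def using mL by (intro int_points_scaleR) (auto simp: weight_lattice_def)
  interpret dilated_simplex V r w
    using r w by unfold_locales
  have origin_weight: "origin_weight x = 1 / m x" if "x \<in> V" for x
  proof -
    have "- w = (\<Sum>x\<in>V. (1 / m x) *\<^sub>R x)"
      by (simp add: w_def)
    then show ?thesis
      using bary_combination[OF that, of "\<lambda>x. 1 / m x"] by (simp only: origin_weight_def mr)
  qed
  have "dual_vertex x \<in> int_points" if x: "x \<in> V" for x
  proof -
    have "dual_vertex x $ i \<in> \<int>" for i
    proof -
      have "m x * bary (axis i 1) 0 x \<in> \<int>"
        using mint bary_in_weight_lattice[OF int_points_axis Ints_0] x by blast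
      then show ?thesis
        using x by (simp add: dual_vertex_def origin_weight bary_def inner_axis')
    qed
    then show ?thesis by (simp add: int_points_def)
  qed
  then have "reflexive dilate"
    using m by (simp add: reflexive_iff origin_weight)
  then show "gorenstein r (convex hull V)"
    using r w lattice_polytope_hull full_dim_hull by (auto simp: gorenstein_def dilate_def)
qed

end

section \<open>Primitive vectors and lattice pyramids\<close>

lemma sum_axis_mult:
  fixes u :: "'a::semiring_1 ^ 'n"
  shows "(\<Sum>k\<in>UNIV. axis i c $ k * u $ k) = c * u $ i" "(\<Sum>k\<in>UNIV. u $ k * axis i c $ k) = u $ i * c"
proof -
  have "(\<Sum>k\<in>UNIV. axis i c $ k * u $ k) = (\<Sum>k\<in>UNIV. if k = i then c * u $ i else 0)"
    "(\<Sum>k\<in>UNIV. u $ k * axis i c $ k) = (\<Sum>k\<in>UNIV. if k = i then u $ i * c else 0)"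
    by (rule sum.cong; simp add: axis_def)+
  then show "(\<Sum>k\<in>UNIV. axis i c $ k * u $ k) = c * u $ i" "(\<Sum>k\<in>UNIV. u $ k * axis i c $ k) = u $ i * c"
    by simp_all
qed

definition shear :: "int ^ 'n \<Rightarrow> int ^ 'n \<Rightarrow> int ^ 'n ^ 'n" where
  "shear f g = (\<chi> i j. (if i = j then 1 else 0) + f $ i * g $ j)"

lemma shear_mult_vec: "shear f g *v u = u + (\<Sum>k\<in>UNIV. g $ k * u $ k) *s f"
proof -
  have "(\<Sum>j\<in>UNIV. ((if i = j then 1 else 0) + f $ i * g $ j) * u $ j) =
      u $ i + (\<Sum>k\<in>UNIV. g $ k * u $ k) * f $ i" for i
  proof -
    have "(\<Sum>j\<in>UNIV. ((if i = j then 1 else 0) + f $ i * g $ j) * u $ j) =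
        (\<Sum>j\<in>UNIV. (if i = j then u $ j else 0) + g $ j * u $ j * f $ i)"
      by (rule sum.cong) (auto simp: algebra_simps)
    then show ?thesis
      by (simp add: sum.distrib sum_distrib_right)
  qed
  then show ?thesis
    by (simp add: vec_eq_iff matrix_vector_mult_def shear_def)
qed

lemma vec_mult_shear: "x v* shear f g = x + (\<Sum>k\<in>UNIV. x $ k * f $ k) *s g"
proof -
  have "(\<Sum>j\<in>UNIV. ((if j = i then 1 else 0) + f $ j * g $ i) * x $ j) =
      x $ i + (\<Sum>k\<in>UNIV. x $ k * f $ k) * g $ i" for i
  proof -
    have "(\<Sum>j\<in>UNIV. ((if j = i then 1 else 0) + f $ j * g $ i) * x $ j) =
        (\<Sum>j\<in>UNIV. (if j = i then x $ j else 0) + x $ j * f $ j * g $ i)"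
      by (rule sum.cong) (auto simp: algebra_simps)
    then show ?thesis
      by (simp add: sum.distrib sum_distrib_right)
  qed
  then show ?thesis
    by (simp add: vec_eq_iff vector_matrix_mult_def shear_def mult.commute)
qed

lemma invertible_shear:
  fixes f g :: "int ^ 'n"
  assumes "(\<Sum>k\<in>UNIV. g $ k * f $ k) = 0"
  shows "invertible (shear f g)"
proof -
  have inv: "shear f' g ** shear f g = mat 1"
    if "f' = - f" "(\<Sum>k\<in>UNIV. g $ k * f $ k) = 0" for f' f :: "int ^ 'n"
  proof -
    have "(\<Sum>k\<in>UNIV. g $ k * (c * f $ k)) = c * (\<Sum>k\<in>UNIV. g $ k * f $ k)" for c
      by (simp add: sum_distrib_left mult.left_commute)
    then have z: "(\<Sum>k\<in>UNIV. g $ k * (c * f $ k)) = 0" for c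
      using that(2) by simp
    have "shear f' g *v (shear f g *v u) = u" for u
      using that(1) z by (simp add: shear_mult_vec vec_eq_iff distrib_left sum.distrib)
    then show ?thesis
      by (simp add: matrix_eq matrix_vector_mul_assoc)
  qed
  have "shear (- f) g ** shear f g = mat 1" "shear f g ** shear (- f) g = mat 1"
    using assms by (auto intro!: inv simp: sum_negf)
  then show ?thesis
    by (auto simp: invertible_def)
qed

text \<open>
  Unimodularity is handled as invertibility over the integers, which composes well and
  avoids computing determinants of shears.
\<close>

lemma det_invertible_int:
  fixes U :: "int ^ 'n ^ 'n"
  assumes "invertible U"
  shows "det U = 1 \<or> det U = - 1"
proof -
  obtain W where "U ** W = mat 1"
    using assms by (auto simp: invertible_def)
  then have "det U * det W = 1"
    by (metis det_I det_mul)
  then show ?thesis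
    by (auto simp: zmult_eq_1_iff)
qed

lemma column_of_invertible_pullback:
  fixes u :: "int ^ 'n"
  assumes "invertible E" "invertible U" "E *v u = U *v y"
  shows "\<exists>W. invertible W \<and> W *v y = u"
proof -
  obtain F where F: "E ** F = mat 1" "F ** E = mat 1"
    using assms(1) by (auto simp: invertible_def)
  then have "invertible F" by (auto simp: invertible_def)
  then have "invertible (F ** U)"
    using assms(2) by (rule invertible_mult)
  moreover have "(F ** U) *v y = u"
    using assms(3) F by (metis matrix_vector_mul_assoc matrix_vector_mul_lid)
  ultimately show ?thesis by blast
qed

text \<open>
  Euclid's algorithm: while two entries are nonzero, a shear subtracts the one of smaller absolute
  value from the other, or adds it, which decreases the sum of absolute values. A primitive vector with one nonzero
  entry is a signed unit vector.
\<close>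

lemma primitive_vector_is_column:
  fixes u :: "int ^ 'n" and i :: 'n
  assumes "\<And>d. (\<And>k. d dvd u $ k) \<Longrightarrow> d dvd 1"
  shows "\<exists>U :: int ^ 'n ^ 'n. invertible U \<and> U *v axis i 1 = u"
  using assms
proof (induction "\<Sum>k\<in>UNIV. nat \<bar>u $ k\<bar>" arbitrary: u rule: less_induct)
  case less
  show ?case
  proof (cases "\<exists>a b. a \<noteq> b \<and> u $ a \<noteq> 0 \<and> u $ b \<noteq> 0")
    case True
    then obtain a b where ab: "a \<noteq> b" "u $ b \<noteq> 0" "\<bar>u $ b\<bar> \<le> \<bar>u $ a\<bar>"
      by (metis linorder_le_cases)
    \<comment> \<open>The sign for which \<open>u $ a - s * u $ b\<close> is smaller in absolute value than \<open>u $ a\<close>.\<close>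
    define s where "s = sgn (u $ a) * sgn (u $ b)"
    let ?E = "shear (axis a (- s)) (axis b 1)"
    define u' where "u' = ?E *v u"
    have u': "u' $ k = (if k = a then u $ a - s * u $ b else u $ k)" for k
      by (simp add: u'_def shear_mult_vec sum_axis_mult) (simp add: axis_def)
    have "nat \<bar>u' $ a\<bar> < nat \<bar>u $ a\<bar>"
      using ab by (auto simp: u' s_def sgn_if)
    then have "(\<Sum>k\<in>UNIV. nat \<bar>u' $ k\<bar>) < (\<Sum>k\<in>UNIV. nat \<bar>u $ k\<bar>)"
      by (intro sum_strict_mono_ex1) (auto simp: u')
    moreover have "d dvd 1" if d: "\<And>k. d dvd u' $ k" for d
    proof (rule less.prems)
      fix k
      have "d dvd u' $ a + s * u' $ b" "d dvd u' $ k"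
        using d by auto
      then show "d dvd u $ k"
        using ab by (auto simp: u' split: if_splits)
    qed
    ultimately obtain U where "invertible U" "U *v axis i 1 = u'"
      using less.hyps[of u'] by blast
    moreover have "invertible ?E"
      using ab by (intro invertible_shear) (simp add: sum_axis_mult, simp add: axis_def)
    ultimately show ?thesis
      by (intro column_of_invertible_pullback[of ?E U]) (simp_all add: u'_def)
  next
    case False
    obtain k where k: "u $ k \<noteq> 0"
      using less.prems[of 0] by auto
    define c where "c = u $ k"
    have u: "u = axis k c"
      using False k by (auto simp: vec_eq_iff axis_def c_def)
    have "c dvd 1"
      by (rule less.prems) (auto simp: u axis_def)
    then have "c = 1 \<or> c = - 1"
      by auto
    then have c: "c * c = 1"
      by auto
    show ?thesis
    proof (cases "k = i")
      case True
      have "(\<Sum>m\<in>UNIV. (if a = m then c else 0) * (if m = b then c else 0)) = (if a = b then 1 else 0)"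
        for a b :: 'n
      proof -
        have "(\<Sum>m\<in>UNIV. (if a = m then c else 0) * (if m = b then c else 0)) =
            (\<Sum>m\<in>UNIV. if m = a then if a = b then c * c else 0 else 0)"
          by (rule sum.cong) auto
        then show ?thesis by (simp add: c)
      qed
      then have "mat c ** mat c = (mat 1 :: int ^ 'n ^ 'n)"
        by (simp add: mat_def matrix_matrix_mult_def vec_eq_iff)
      then have "invertible (mat c :: int ^ 'n ^ 'n)"
        by (auto simp: invertible_def)
      moreover have "mat c *v axis i 1 = u"
        unfolding u True matrix_vector_mult_def
        by (simp only: sum_axis_mult vec_eq_iff vec_lambda_beta) (simp add: mat_def axis_def)
      ultimately show ?thesis by blast
    next
      case False
      \<comment> \<open>Two shears move the signed unit vector \<open>axis k c\<close> through \<open>axis k c + axis i 1\<close> to \<open>axis i 1\<close>.\<close>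
      let ?E = "shear (axis i c) (axis k 1)" and ?F = "shear (axis k (- c)) (axis i 1)"
      have Eu: "?E *v u = axis k c + axis i 1"
        using c by (simp add: u shear_mult_vec sum_axis_mult) (simp add: axis_def vec_eq_iff)
      have "?F *v (?E *v u) = axis i 1"
        unfolding Eu using False
        by (simp only: shear_mult_vec sum_axis_mult) (simp add: axis_def vec_eq_iff)
      moreover have "invertible ?E" "invertible ?F"
        using False by (auto intro!: invertible_shear simp: sum_axis_mult, auto simp: axis_def)
      ultimately show ?thesis
        by (intro column_of_invertible_pullback[of "?F ** ?E" "mat 1"])
          (auto simp: invertible_mult matrix_vector_mul_assoc[symmetric] invertible_def[of "mat 1"] intro!: exI[of _ "mat 1"])
    qed
  qed
qed

text \<open>
  After \<open>u\<close> has become a column, \<open>z\<close> has entry one in that coordinate, and a shear that fixes the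
  column clears the other entries of \<open>z\<close>.
\<close>

lemma unimodular_of_dual_pair:
  fixes u z :: "int ^ 'n" and i :: 'n
  assumes zu: "(\<Sum>k\<in>UNIV. z $ k * u $ k) = 1"
  obtains U :: "int ^ 'n ^ 'n" where "invertible U" "U *v axis i 1 = u" "z v* U = axis i 1"
proof -
  have "d dvd 1" if "\<And>k. d dvd u $ k" for d
    unfolding zu[symmetric] using that by (intro dvd_sum) simp
  then obtain U where U: "invertible U" "U *v axis i 1 = u"
    using primitive_vector_is_column by blast
  define y where "y = z v* U"
  have Ui: "U $ k $ i = u $ k" for k
    using U(2) by (auto simp: vec_eq_iff matrix_vector_mult_def axis_def if_distrib cong: if_cong)
  have yi: "y $ i = 1"
    using zu by (simp add: y_def vector_matrix_mult_def Ui mult.commute)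
  let ?S = "shear (axis i 1) (axis i 1 - y)"
  have S: "invertible ?S"
  proof (rule invertible_shear)
    show "(\<Sum>k\<in>UNIV. (axis i 1 - y) $ k * (axis i 1 :: int ^ 'n) $ k) = 0"
      unfolding sum_axis_mult(2) using yi by (simp add: axis_def)
  qed
  have S1: "?S *v axis i 1 = axis i 1"
    using yi by (simp only: shear_mult_vec sum_axis_mult) (simp add: axis_def)
  have S2: "y v* ?S = axis i 1"
    using yi by (simp add: vec_mult_shear sum_axis_mult)
  show ?thesis
  proof (rule that)
    show "invertible (U ** ?S)"
      using U(1) S by (rule invertible_mult)
    show "(U ** ?S) *v axis i 1 = u"
      using U(2) S1 by (simp add: matrix_vector_mul_assoc[symmetric])
    show "z v* (U ** ?S) = axis i 1"
      using S2 by (simp add: vector_matrix_mul_assoc[symmetric] y_def)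
  qed
qed

lemma affine_independent_injective_linear_image:
  fixes f :: "'a::euclidean_space \<Rightarrow> 'b::euclidean_space"
  assumes f: "linear f" "inj f" and S: "\<not> affine_dependent S"
  shows "\<not> affine_dependent (f ` S)"
proof
  assume "affine_dependent (f ` S)"
  then obtain y where y: "y \<in> S" "f y \<in> affine hull (f ` S - {f y})"
    by (auto simp: affine_dependent_def)
  have "f ` S - {f y} = f ` (S - {y})"
    using f(2) by (auto simp: inj_def)
  then have "f y \<in> f ` (affine hull (S - {y}))"
    using y(2) f(1) by (simp add: affine_hull_linear_image linear_conv_bounded_linear)
  then have "y \<in> affine hull (S - {y})"
    using f(2) by (auto simp: inj_def)
  then show False
    using S y(1) by (auto simp: affine_dependent_def)
qed

lemma real_matrix_mult: "real_matrix (U ** W) = real_matrix U ** real_matrix W"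
  by (simp add: real_matrix_def matrix_matrix_mult_def vec_eq_iff)

lemma real_matrix_mat_1: "real_matrix (mat 1) = mat 1"
  by (simp add: real_matrix_def mat_def vec_eq_iff)

lemma int_points_vec_mult:
  fixes U :: "int ^ 'n ^ 'n"
  shows "x \<in> int_points \<Longrightarrow> x v* real_matrix U \<in> int_points"
  by (auto simp: int_points_def vector_matrix_mult_def real_matrix_def)

context full_simplex
begin

text \<open>
  If all weights at \<open>x\<close> are integral, the facet normal of \<open>x\<close> is an integral vector. It vanishes on the edges from a
  vertex \<open>b\<close> to the vertices other than \<open>x\<close>, and equals one on the edge from \<open>b\<close> to \<open>x\<close>. A unimodular
  coordinate change makes the normal a coordinate and this edge the corresponding unit vector.
\<close>

theorem pyramid_if_integral_weight:
  assumes x: "x \<in> V" and int: "\<And>l. l \<in> weight_lattice V \<Longrightarrow> l x \<in> \<int>"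
  shows "is_lattice_pyramid (convex hull V)"
proof -
  obtain b where b: "b \<in> V" "b \<noteq> x" by (rule ex_other)
  fix i :: 'n
  have "facet_normal x $ k \<in> \<int>" for k
    using int[OF bary_in_weight_lattice[OF int_points_axis[of k], of 0]]
    by (simp add: bary_def inner_axis')
  then have "\<forall>k. \<exists>u. facet_normal x $ k = of_int u" by (metis Ints_cases)
  then obtain uf where uf: "\<And>k. facet_normal x $ k = of_int (uf k)" by metis
  have "x - b \<in> int_points"
    using x b V_int by (auto intro: int_points_diff)
  then have "\<forall>k. \<exists>z. (x - b) $ k = of_int z" by (auto simp: int_points_def elim: Ints_cases)
  then obtain zf where zf: "\<And>k. (x - b) $ k = of_int (zf k)" by metis
  have edge: "(y - b) \<bullet> facet_normal x = (if y = x then 1 else 0)" if "y \<in> V" for y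
    using bary_vertex[OF x that] bary_vertex[OF x b(1)] b(2) by (simp add: bary_def inner_diff_left)
  have "real_of_int (\<Sum>k\<in>UNIV. zf k * uf k) = (x - b) \<bullet> facet_normal x"
    by (simp add: inner_vec_def uf zf del: vector_minus_component)
  then have "(\<Sum>k\<in>UNIV. (\<chi> k. zf k) $ k * (\<chi> k. uf k) $ k) = 1"
    using edge[OF x] by (metis (no_types, lifting) of_int_eq_1_iff sum.cong vec_lambda_beta)
  then obtain U where U: "invertible U" "U *v axis i 1 = (\<chi> k. uf k)" "(\<chi> k. zf k) v* U = axis i 1"
    by (rule unimodular_of_dual_pair)
  let ?R = "real_matrix U"
  \<comment> \<open>This translation sends \<open>b\<close> to the origin.\<close>
  define w where "w = - (b v* ?R)"
  define F where "F v = v v* ?R + w" for v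
  have F: "F v = (v - b) v* ?R" for v
    by (simp add: F_def w_def algebra_simps)
  obtain W where "U ** W = mat 1"
    using U(1) by (auto simp: invertible_def)
  then have RW: "?R ** real_matrix W = mat 1"
    by (metis real_matrix_mat_1 real_matrix_mult)
  have inj: "inj (\<lambda>v. v v* ?R)"
    by (rule inj_on_inverseI[of _ "\<lambda>v. v v* real_matrix W"]) (simp add: vector_matrix_mul_assoc RW)
  have lin: "linear (\<lambda>v. v v* ?R)"
    by (rule linearI) (simp_all add: algebra_simps scaleR_vector_matrix_assoc)
  have w: "w \<in> int_points"
    using int_points_scaleR[OF _ int_points_vec_mult, of "-1" b U] b V_int by (auto simp: w_def)
  have F_int: "F v \<in> int_points" if "v \<in> V" for v
    using that V_int w by (auto simp: F_def intro!: int_points_add int_points_vec_mult)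
  have Ui: "U $ k $ i = uf k" for k
    using U(2) by (auto simp: vec_eq_iff matrix_vector_mult_def axis_def if_distrib cong: if_cong)
  have Fx: "F x = axis i 1"
  proof -
    have "(\<Sum>k\<in>UNIV. zf k * U $ k $ j) = (if j = i then 1 else 0)" for j
      using U(3) by (auto simp: vec_eq_iff vector_matrix_mult_def axis_def)
    from this[THEN arg_cong[where f = real_of_int]]
    show ?thesis
      by (simp add: F vec_eq_iff vector_matrix_mult_def axis_def zf real_matrix_def
          del: vector_minus_component)
  qed
  have Fi: "F y $ i = (y - b) \<bullet> facet_normal x" for y
    by (simp add: F vector_matrix_mult_def real_matrix_def Ui inner_vec_def uf mult.commute)
  let ?B = "F ` (V - {x})"
  define D' where "D' = convex hull ?B"
  have Faff: "F = (+) w \<circ> (\<lambda>v. v v* ?R)"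
    by (auto simp: F_def add.commute)
  have injF: "inj F"
    using inj by (auto simp: F_def inj_def)
  have "D' \<subseteq> {y. y $ i = 0}"
    unfolding D'_def
  proof (rule hull_minimal)
    show "?B \<subseteq> {y. y $ i = 0}"
      using edge by (auto simp: Fi)
    show "convex {y :: real ^ 'n. y $ i = 0}"
      by (auto simp: convex_def)
  qed
  moreover have "lattice_simplex (CARD('n) - 1) D'"
  proof -
    have "\<not> affine_dependent (V - {x})"
      using affine_independent affine_dependent_subset by blast
    then have "\<not> affine_dependent ((\<lambda>v. v v* ?R) ` (V - {x}))"
      using lin inj by (rule affine_independent_injective_linear_image[rotated 2])
    then have "\<not> affine_dependent ?B"
      by (simp only: Faff image_comp[symmetric] affine_dependent_translation_eq[symmetric]) simp
    moreover have "card ?B = CARD('n)"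
      using inj_on_subset[OF injF] x card_V finite_V by (subst card_image) auto
    ultimately have "int (CARD('n) - 1) simplex D'"
      unfolding simplex_def D'_def by (intro exI[of _ ?B]) (auto simp: Suc_le_eq of_nat_diff)
    moreover have "vertices D' \<subseteq> ?B"
      unfolding vertices_def D'_def using extreme_point_of_convex_hull by blast
    then have "lattice_polytope D'"
      unfolding lattice_polytope_def polytope_def
      using F_int finite_V D'_def by (auto intro!: exI[of _ ?B])
    ultimately show ?thesis by (simp add: lattice_simplex_def)
  qed
  moreover have "unimodularly_equivalent (convex hull V) (pyramid i D')"
    unfolding unimodularly_equivalent_def
  proof (intro exI conjI)
    show "det U = 1 \<or> det U = - 1"
      using U(1) by (rule det_invertible_int)
    show "w \<in> int_points" by (rule w)
    have "pyramid i D' = convex hull (insert (F x) ?B)"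
      unfolding pyramid_def D'_def Fx by (rule hull_insert[symmetric])
    also have "insert (F x) ?B = (+) w ` ((\<lambda>v. v v* ?R) ` V)"
      using x by (auto simp: Faff image_comp)
    also have "convex hull \<dots> = (+) w ` ((\<lambda>v. v v* ?R) ` (convex hull V))"
      by (simp only: convex_hull_translation convex_hull_linear_image[OF lin])
    finally show "pyramid i D' = (\<lambda>v. v v* ?R + w) ` (convex hull V)"
      by (simp add: image_image add.commute)
  qed
  ultimately show ?thesis
    unfolding is_lattice_pyramid_def by blast
qed

end

section \<open>The simplex group as a subgroup of the torus\<close>

definition torus_point :: "nat \<Rightarrow> (nat \<Rightarrow> real) \<Rightarrow> (nat \<Rightarrow> real set)" where
  "torus_point d l = (\<lambda>i\<in>{..d}. mod_Z (l i))"

lemma mod_Z_eq: "mod_Z x = {y. y - x \<in> \<int>}"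
proof -
  have "mod_Z x = {h + x | h. h \<in> \<int>}"
    by (auto simp: mod_Z_def r_coset_def real_add_group_def)
  also have "\<dots> = {y. y - x \<in> \<int>}"
    by (metis (no_types, lifting) add_diff_cancel diff_add_cancel)
  finally show ?thesis .
qed

lemma mod_Z_eq_iff: "mod_Z x = mod_Z y \<longleftrightarrow> x - y \<in> \<int>"
proof
  assume "mod_Z x = mod_Z y"
  moreover have "x \<in> mod_Z x" by (simp add: mod_Z_eq)
  ultimately have "x \<in> mod_Z y" by simp
  then show "x - y \<in> \<int>" by (simp add: mod_Z_eq)
next
  assume xy: "x - y \<in> \<int>"
  have "z - x \<in> \<int> \<longleftrightarrow> z - y \<in> \<int>" for z
    using Ints_add[OF _ xy, of "z - x"] Ints_diff[OF _ xy, of "z - y"] by (simp add: algebra_simps) argo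
  then show "mod_Z x = mod_Z y"
    by (simp add: mod_Z_eq)
qed

lemma comm_group_real_add: "comm_group real_add_group"
proof (rule comm_groupI)
  fix x assume "x \<in> carrier real_add_group"
  show "\<exists>y\<in>carrier real_add_group. y \<otimes>\<^bsub>real_add_group\<^esub> x = \<one>\<^bsub>real_add_group\<^esub>"
    by (rule bexI[of _ "- x"]) (auto simp: real_add_group_def)
qed (auto simp: real_add_group_def)

lemma Ints_normal: "\<int> \<lhd> real_add_group"
proof -
  interpret comm_group real_add_group by (rule comm_group_real_add)
  have inv: "inv\<^bsub>real_add_group\<^esub> x = - x" for x
    by (rule inv_equality) (auto simp: real_add_group_def)
  have "subgroup \<int> real_add_group"
    by (rule subgroupI) (auto simp: inv, auto simp: real_add_group_def)
  then show ?thesis by (rule subgroup_imp_normal)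
qed

lemma carrier_RmodZ: "carrier RmodZ = range mod_Z"
  by (auto simp: RmodZ_def FactGroup_def RCOSETS_def mod_Z_def real_add_group_def)

lemma group_RmodZ: "group RmodZ"
  unfolding RmodZ_def by (rule normal.factorgroup_is_group[OF Ints_normal])

lemma mult_RmodZ: "mod_Z x \<otimes>\<^bsub>RmodZ\<^esub> mod_Z y = mod_Z (x + y)"
  using normal.rcos_sum[OF Ints_normal, of x y]
  by (simp add: RmodZ_def FactGroup_def mod_Z_def) (simp add: real_add_group_def)

lemma one_RmodZ: "\<one>\<^bsub>RmodZ\<^esub> = mod_Z 0"
  by (simp add: RmodZ_def FactGroup_def mod_Z_eq)

lemma group_torus: "group (torus d)"
  unfolding torus_def by (intro product_group group_RmodZ)

lemma carrier_torus: "carrier (torus d) = range (torus_point d)"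
proof (intro equalityI subsetI)
  fix c assume "c \<in> carrier (torus d)"
  then have c: "c \<in> (\<Pi>\<^sub>E i\<in>{..d}. range mod_Z)"
    by (simp add: torus_def carrier_RmodZ)
  then have "\<forall>i\<in>{..d}. \<exists>l. c i = mod_Z l" by (auto simp: PiE_iff)
  then obtain l where "\<forall>i\<in>{..d}. c i = mod_Z (l i)" by metis
  then have "c = torus_point d l"
    using c by (auto simp: torus_point_def PiE_iff extensional_def fun_eq_iff)
  then show "c \<in> range (torus_point d)" by blast
qed (auto simp: torus_point_def torus_def carrier_RmodZ)

lemma mult_torus: "torus_point d k \<otimes>\<^bsub>torus d\<^esub> torus_point d l = torus_point d (\<lambda>i. k i + l i)"
  unfolding torus_def torus_point_def mult_product_group
  by (rule restrict_ext) (simp add: mult_RmodZ)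

lemma one_torus: "\<one>\<^bsub>torus d\<^esub> = torus_point d (\<lambda>i. 0)"
  by (auto simp: torus_def torus_point_def one_RmodZ)

lemma torus_point_eq_iff: "torus_point d k = torus_point d l \<longleftrightarrow> (\<forall>i\<le>d. k i - l i \<in> \<int>)"
proof -
  have "torus_point d k = torus_point d l \<longleftrightarrow> (\<forall>i\<le>d. mod_Z (k i) = mod_Z (l i))"
    by (auto simp: torus_point_def fun_eq_iff restrict_def)
  then show ?thesis by (simp add: mod_Z_eq_iff)
qed

lemma inv_torus: "inv\<^bsub>torus d\<^esub> torus_point d l = torus_point d (\<lambda>i. - l i)"
proof -
  interpret group "torus d" by (rule group_torus)
  show ?thesis
    by (rule inv_equality) (auto simp: mult_torus one_torus carrier_torus)
qed

lemma generate_torus_point: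
  "generate (torus d) {torus_point d l} = {torus_point d (\<lambda>i. of_int k * l i) | k. True}"
proof (intro equalityI subsetI)
  fix c assume "c \<in> generate (torus d) {torus_point d l}"
  then show "c \<in> {torus_point d (\<lambda>i. of_int k * l i) | k. True}"
  proof induction
    case one
    show ?case by (auto simp: one_torus intro!: exI[of _ 0])
  next
    case (incl h)
    then show ?case by (auto intro!: exI[of _ 1])
  next
    case (inv h)
    then show ?case by (auto simp: inv_torus intro!: exI[of _ "-1"])
  next
    case (eng h1 h2)
    then obtain j k where "h1 = torus_point d (\<lambda>i. of_int j * l i)" "h2 = torus_point d (\<lambda>i. of_int k * l i)"
      by auto
    then show ?case
      by (auto simp: mult_torus distrib_right intro!: exI[of _ "j + k"])
  qed
next
  fix c assume "c \<in> {torus_point d (\<lambda>i. of_int k * l i) | k. True}"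
  then obtain k where c: "c = torus_point d (\<lambda>i. of_int k * l i)" by blast
  let ?G = "generate (torus d) {torus_point d l}"
  have "torus_point d (\<lambda>i. of_int k * l i) \<in> ?G"
  proof (induction k rule: int_induct[where k = 0])
    case base
    show ?case using generate.one[of "torus d" "{torus_point d l}"] by (simp add: one_torus)
  next
    case (step1 k)
    have "torus_point d l \<in> ?G" by (rule generate.incl) simp
    from generate.eng[OF step1(2) this] show ?case
      by (simp add: mult_torus distrib_right)
  next
    case (step2 k)
    have "torus_point d (\<lambda>i. - l i) \<in> ?G"
      unfolding inv_torus[symmetric] by (rule generate.inv) simp
    from generate.eng[OF step2(2) this] show ?case
      by (simp add: mult_torus left_diff_distrib)
  qed
  then show "c \<in> ?G" by (simp add: c)
qed

lemma simplex_group_eq_weights: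
  fixes v :: "nat \<Rightarrow> real ^ 'n"
  assumes v: "bij_betw v {..CARD('n)} V"
  shows "simplex_group v = {torus_point CARD('n) (\<lambda>i. l (v i)) | l. l \<in> weight_lattice V}"
proof -
  have sums: "(\<Sum>i\<le>CARD('n). l (v i) *\<^sub>R v i) = (\<Sum>x\<in>V. l x *\<^sub>R x)"
    "(\<Sum>i\<le>CARD('n). l (v i)) = (\<Sum>x\<in>V. l x)" for l
    by (rule sum.reindex_bij_betw[OF v])+
  show ?thesis
  proof (intro equalityI subsetI)
    fix c assume "c \<in> simplex_group v"
    then obtain l where c: "c \<in> carrier (torus CARD('n))" and l: "\<forall>i\<le>CARD('n). l i \<in> c i"
      and lint: "(\<Sum>i\<le>CARD('n). l i *\<^sub>R v i) \<in> int_points" "(\<Sum>i\<le>CARD('n). l i) \<in> \<int>"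
      by (auto simp: simplex_group_def)
    obtain l0 where c0: "c = torus_point CARD('n) l0"
      using c by (auto simp: carrier_torus)
    have cl: "c = torus_point CARD('n) l"
      using l unfolding c0 torus_point_eq_iff
      by (auto simp: torus_point_def mod_Z_eq) (metis Ints_minus minus_diff_eq)
    define l' where "l' x = l (inv_into {..CARD('n)} v x)" for x
    have l': "l' (v i) = l i" if "i \<le> CARD('n)" for i
      using v that by (simp add: l'_def bij_betw_def)
    have "(\<Sum>i\<le>CARD('n). l' (v i) *\<^sub>R v i) = (\<Sum>i\<le>CARD('n). l i *\<^sub>R v i)"
      "(\<Sum>i\<le>CARD('n). l' (v i)) = (\<Sum>i\<le>CARD('n). l i)"
      using l' by (auto intro: sum.cong)
    then have "l' \<in> weight_lattice V"
      using lint by (simp add: weight_lattice_def sums)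
    moreover have "c = torus_point CARD('n) (\<lambda>i. l' (v i))"
      unfolding cl torus_point_eq_iff using l' by simp
    ultimately show "c \<in> {torus_point CARD('n) (\<lambda>i. l (v i)) | l. l \<in> weight_lattice V}"
      by blast
  next
    fix c assume "c \<in> {torus_point CARD('n) (\<lambda>i. l (v i)) | l. l \<in> weight_lattice V}"
    then obtain l where l: "l \<in> weight_lattice V" and c: "c = torus_point CARD('n) (\<lambda>i. l (v i))"
      by blast
    have "c \<in> carrier (torus CARD('n))" by (simp add: c carrier_torus)
    moreover have "\<forall>i\<le>CARD('n). l (v i) \<in> c i"
      by (simp add: c torus_point_def mod_Z_eq)
    moreover have "(\<Sum>i\<le>CARD('n). l (v i) *\<^sub>R v i) \<in> int_points" "(\<Sum>i\<le>CARD('n). l (v i)) \<in> \<int>"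
      using l by (simp_all only: sums weight_lattice_def mem_Collect_eq)
    ultimately show "c \<in> simplex_group v"
      unfolding simplex_group_def by (auto intro!: exI[of _ "\<lambda>i. l (v i)"])
  qed
qed

text \<open>
  Generation of the group by one torus point, stated for weights: \<open>a\<close> is a weight and every other weight is a
  multiple of it modulo the integers.
\<close>

lemma (in full_simplex) simplex_group_generated_iff:
  assumes v: "bij_betw v {..CARD('n)} V" and a: "\<And>i. i \<le> CARD('n) \<Longrightarrow> a (v i) = g i"
  shows "simplex_group v = generate (torus CARD('n)) {torus_point CARD('n) g} \<longleftrightarrow>
    a \<in> weight_lattice V \<and>
    (\<forall>l\<in>weight_lattice V. \<exists>k :: int. \<forall>x\<in>V. l x - of_int k * a x \<in> \<int>)"
    (is "?L = ?G \<longleftrightarrow> ?R")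
proof -
  let ?n = "CARD('n)"
  have onV: "(\<forall>x\<in>V. P x) \<longleftrightarrow> (\<forall>i\<le>?n. P (v i))" for P
    using v by (auto simp: bij_betw_def)
  have eq: "torus_point ?n (\<lambda>i. l (v i)) = torus_point ?n (\<lambda>i. of_int k * g i) \<longleftrightarrow>
      (\<forall>x\<in>V. l x - of_int k * a x \<in> \<int>)" for l k
    by (auto simp: onV torus_point_eq_iff a)
  have L: "?L = {torus_point ?n (\<lambda>i. l (v i)) | l. l \<in> weight_lattice V}"
    using v by (rule simplex_group_eq_weights)
  have G: "?G = {torus_point ?n (\<lambda>i. of_int k * g i) | k. True}"
    by (rule generate_torus_point)
  show ?thesis
  proof
    assume LG: "?L = ?G"
    have "torus_point ?n (\<lambda>i. of_int 1 * g i) \<in> ?L"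
      unfolding LG G by blast
    then obtain l where l: "l \<in> weight_lattice V"
      and "torus_point ?n (\<lambda>i. l (v i)) = torus_point ?n (\<lambda>i. of_int 1 * g i)"
      unfolding L by auto
    then have "\<forall>x\<in>V. l x - of_int 1 * a x \<in> \<int>"
      by (simp only: eq)
    then have "(\<lambda>x. l x - a x) \<in> weight_lattice V"
      by (intro weight_lattice_Ints V_int) auto
    from weight_lattice_diff[OF l this] have "a \<in> weight_lattice V"
      by simp
    moreover have "\<exists>k :: int. \<forall>x\<in>V. l x - of_int k * a x \<in> \<int>" if "l \<in> weight_lattice V" for l
    proof -
      have "torus_point ?n (\<lambda>i. l (v i)) \<in> ?G"
        unfolding LG[symmetric] L using that by blast
      then show ?thesis
        unfolding G using eq by auto
    qed
    ultimately show ?R by blast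
  next
    assume R: ?R
    show "?L = ?G"
    proof (intro equalityI subsetI)
      fix c assume "c \<in> ?L"
      then obtain l where l: "l \<in> weight_lattice V" "c = torus_point ?n (\<lambda>i. l (v i))"
        unfolding L by blast
      then obtain k :: int where "\<forall>x\<in>V. l x - of_int k * a x \<in> \<int>"
        using R by blast
      then show "c \<in> ?G"
        unfolding G l(2) using eq[of l k] by blast
    next
      fix c assume "c \<in> ?G"
      then obtain k :: int where k: "c = torus_point ?n (\<lambda>i. of_int k * g i)"
        unfolding G by blast
      have "(\<lambda>x. of_int k * a x) \<in> weight_lattice V"
        using R by (intro weight_lattice_scale) auto
      moreover have "c = torus_point ?n (\<lambda>i. of_int k * a (v i))"
        by (simp add: k torus_point_eq_iff a)
      ultimately show "c \<in> ?L"
        unfolding L by (intro CollectI exI[of _ "\<lambda>x. of_int k * a x"] conjI)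
    qed
  qed
qed

section \<open>Simplices whose normalized volume is a product of two primes\<close>

lemma of_nat_div_in_Ints_iff:
  assumes "m > 0"
  shows "real n / real m \<in> \<int> \<longleftrightarrow> m dvd n"
proof
  assume "real n / real m \<in> \<int>"
  then obtain z where "real n / real m = of_int z" by (elim Ints_cases)
  then have "real_of_int (int n) = real_of_int (z * int m)"
    using assms by (simp add: field_simps)
  then have "int n = z * int m"
    by (simp only: of_int_eq_iff)
  then show "m dvd n"
    by (metis dvd_triv_right int_dvd_int_iff)
next
  assume "m dvd n"
  then show "real n / real m \<in> \<int>"
    using assms by (auto elim!: dvdE)
qed

lemma dvd_prime_mult_cases:
  fixes p q m :: nat
  assumes "prime p" "prime q" "m dvd p * q"
  shows "m \<in> {1, p, q, p * q}"
proof -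
  obtain a b where ab: "m = a * b" "a dvd p" "b dvd q"
    using division_decomp[OF assms(3)] by blast
  then have "a = 1 \<or> a = p" "b = 1 \<or> b = q"
    using assms by (auto simp: prime_nat_iff)
  then show ?thesis using ab by auto
qed

context full_simplex
begin

lemma based_enumeration:
  assumes "b \<in> V"
  obtains h :: "'n \<Rightarrow> real ^ 'n" where "bij_betw h UNIV (V - {b})"
proof -
  have "card (V - {b}) = CARD('n)"
    using assms finite_V by (simp add: card_V)
  then show ?thesis
    using finite_same_card_bij[of "UNIV :: 'n set" "V - {b}"] finite_V that by auto
qed

end

locale simplex_of_volume = full_simplex V for V :: "(real ^ 'n) set" +
  fixes N :: nat
  assumes volume: "normalized_volume (convex hull V) = real N" and N_pos: "N > 0"
begin

lemma abs_det_edges: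
  assumes "b \<in> V" "bij_betw h UNIV (V - {b})"
  shows "\<bar>det (\<chi> i. h i - b)\<bar> = real N"
  using normalized_volume_simplex[OF finite_V card_V assms] volume by simp

lemma mult_volume_in_Ints_iff:
  assumes "b \<in> V" "bij_betw h UNIV (V - {b})"
  shows "c * det (\<chi> i. h i - b) \<in> \<int> \<longleftrightarrow> real N * c \<in> \<int>"
  using abs_det_edges[OF assms] by (auto simp: abs_if mult.commute split: if_splits)
    (metis Ints_minus minus_mult_right minus_minus)+

lemma volume_mult_weight_in_Ints:
  assumes l: "l \<in> weight_lattice V" and x: "x \<in> V"
  shows "real N * l x \<in> \<int>"
proof -
  obtain b where b: "b \<in> V" "b \<noteq> x" by (rule ex_other)
  obtain h :: "'n \<Rightarrow> real ^ 'n" where h: "bij_betw h UNIV (V - {b})"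
    using b(1) by (rule based_enumeration)
  then have "x \<in> range h"
    using b x bij_betw_imp_surj_on by blast
  then obtain k where k: "h k = x" by blast
  show ?thesis
    using det_mult_weights_in_Ints[OF finite_V V_int b(1) h l, of k]
    by (simp add: mult_volume_in_Ints_iff[OF b(1) h] k)
qed

text \<open>
  An integral value of \<open>l\<close> at \<open>x\<close> may be subtracted without leaving the lattice, which reduces to the
  case where \<open>l\<close> vanishes at \<open>x\<close>.
\<close>

lemma volume_mult_weight_pair_in_Ints:
  assumes k: "k \<in> weight_lattice V" and l: "l \<in> weight_lattice V"
    and xyb: "x \<in> V" "y \<in> V" "b \<in> V" "x \<noteq> y" "b \<noteq> x" "b \<noteq> y"
    and lx: "l x \<in> \<int>"
  shows "real N * (k x * l y) \<in> \<int>"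
proof -
  obtain h :: "'n \<Rightarrow> real ^ 'n" where h: "bij_betw h UNIV (V - {b})"
    using xyb(3) by (rule based_enumeration)
  have "x \<in> range h"
    using h xyb bij_betw_imp_surj_on by blast
  then obtain i where i: "h i = x" by blast
  have "y \<in> range h"
    using h xyb bij_betw_imp_surj_on by blast
  then obtain j where j: "h j = y" by blast
  define l' where "l' z = l z - (if z = x then l x else 0)" for z
  have "(\<lambda>z. if z = x then l x else 0) \<in> weight_lattice V"
    using lx by (intro weight_lattice_Ints V_int) auto
  then have l': "l' \<in> weight_lattice V"
    unfolding l'_def using l by (rule weight_lattice_diff[rotated])
  have "k (h i) * l' (h j) * det (\<chi> i. h i - b) \<in> \<int>"
    using xyb(4) i j
    by (intro det_mult_weight_pairs_in_Ints[OF finite_V V_int xyb(3) h k l']) (auto simp: l'_def)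
  then show ?thesis
    using xyb(4) by (simp add: mult_volume_in_Ints_iff[OF xyb(3) h] i j l'_def)
qed

lemma volume_dvd_exponent_power:
  assumes "\<And>l x. l \<in> weight_lattice V \<Longrightarrow> x \<in> V \<Longrightarrow> real k * l x \<in> \<int>"
  shows "N dvd k ^ CARD('n)"
proof -
  obtain b where b: "b \<in> V"
    using ex_other by blast
  then obtain h :: "'n \<Rightarrow> real ^ 'n" where h: "bij_betw h UNIV (V - {b})"
    by (rule based_enumeration)
  show ?thesis
    using det_dvd_exponent_power[OF finite_V V_int b h abs_det_edges[OF b h] N_pos] assms
    by blast
qed

text \<open>
  Some multiple \<open>k\<close> makes \<open>l - k * g\<close> integral at \<open>x\<close>. Then
  \<open>N * g x * (l - k * g) y\<close> is an integer for every vertex \<open>y\<close> but \<open>x\<close> and one base vertex. Since \<open>p\<close> divides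
  neither \<open>q\<close> nor the numerator of \<open>g x\<close>, it follows that \<open>l - k * g\<close> is integral at \<open>y\<close>. The base vertex is
  settled by the integral total.
\<close>

lemma prime_torsion_cyclic:
  assumes p: "prime p" and N: "N = p * q" "\<not> p dvd q"
    and g: "g \<in> weight_lattice V" and l: "l \<in> weight_lattice V"
    and pg: "\<And>y. y \<in> V \<Longrightarrow> real p * g y \<in> \<int>" and pl: "\<And>y. y \<in> V \<Longrightarrow> real p * l y \<in> \<int>"
    and x: "x \<in> V" "g x \<notin> \<int>"
  obtains k :: int where "\<And>y. y \<in> V \<Longrightarrow> l y - of_int k * g y \<in> \<int>"
proof -
  have p0: "real p > 0" using p by (simp add: prime_gt_0_nat)
  have pp: "prime (int p)" using p by simp
  obtain a where a: "real p * g x = of_int a" using pg[OF x(1)] by (elim Ints_cases)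
  obtain c where c: "real p * l x = of_int c" using pl[OF x(1)] by (elim Ints_cases)
  have gx: "g x = of_int a / real p" and lx: "l x = of_int c / real p"
    using a c p0 by (simp_all add: field_simps)
  have "\<not> int p dvd a"
  proof
    assume "int p dvd a"
    then obtain e where "a = int p * e" ..
    then have "g x = of_int e" using p0 by (simp add: gx)
    then show False using x(2) by simp
  qed
  then have "coprime a (int p)"
    using pp by (metis coprime_commute prime_imp_coprime)
  then obtain u v where uv: "u * a + v * int p = 1"
    by (metis bezout_int coprime_iff_gcd_eq_1)
  define k where "k = c * u"
  define \<mu> where "\<mu> y = l y - of_int k * g y" for y
  have \<mu>: "\<mu> \<in> weight_lattice V"
    unfolding \<mu>_def by (intro weight_lattice_diff weight_lattice_scale l g) auto
  have "c - k * a = c * v * int p"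
    using uv unfolding k_def by algebra
  moreover have "\<mu> x = of_int (c - k * a) / real p"
    by (simp add: \<mu>_def gx lx diff_divide_distrib)
  ultimately have "\<mu> x = of_int (c * v)"
    using p0 by simp
  then have \<mu>x: "\<mu> x \<in> \<int>" by simp
  obtain b where b: "b \<in> V" "b \<noteq> x" by (rule ex_other)
  have other: "\<mu> y \<in> \<int>" if y: "y \<in> V" "y \<noteq> b" for y
  proof (cases "y = x")
    case False
    have "real p * \<mu> y = real p * l y - of_int k * (real p * g y)"
      by (simp add: \<mu>_def algebra_simps)
    then have "real p * \<mu> y \<in> \<int>"
      using pg[OF y(1)] pl[OF y(1)] by simp
    then obtain e where e: "real p * \<mu> y = of_int e" by (elim Ints_cases)
    have \<mu>y: "\<mu> y = of_int e / real p" using e p0 by (simp add: field_simps)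
    have "real N * (g x * \<mu> y) \<in> \<int>"
      using g \<mu> x y b False \<mu>x by (intro volume_mult_weight_pair_in_Ints[of g \<mu> x y b]) auto
    then obtain f where "real N * (g x * \<mu> y) = of_int f" by (elim Ints_cases)
    then have "real q * of_int a * of_int e = of_int f * real p"
      using p0 by (simp add: N gx \<mu>y field_simps)
    then have "real_of_int (int q * a * e) = real_of_int (f * int p)"
      by simp
    then have "int q * a * e = f * int p"
      by (simp only: of_int_eq_iff)
    then have "int p dvd int q * a * e" by simp
    then have "int p dvd e"
      using pp N(2) \<open>\<not> int p dvd a\<close> by (simp add: prime_dvd_mult_iff)
    then obtain e' where "e = int p * e'" ..
    then show ?thesis using p0 by (simp add: \<mu>y)
  qed (use \<mu>x in simp)
  have "(\<Sum>y\<in>V. \<mu> y) \<in> \<int>"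
    using \<mu> by (simp add: weight_lattice_def)
  moreover have "(\<Sum>y\<in>V. \<mu> y) = \<mu> b + (\<Sum>y\<in>V - {b}. \<mu> y)"
    using finite_V b(1) by (rule sum.remove)
  moreover have "(\<Sum>y\<in>V - {b}. \<mu> y) \<in> \<int>"
    using other by (intro Ints_sum) auto
  ultimately have "\<mu> b \<in> \<int>"
    by (metis Ints_diff add_diff_cancel_right')
  with other have "\<mu> y \<in> \<int>" if "y \<in> V" for y
    using that by blast
  then show ?thesis
    by (intro that[of k]) (simp add: \<mu>_def)
qed

text \<open>
  Otherwise all denominators are \<open>q\<close>, so \<open>q\<close> kills all weights modulo the integers, although \<open>p\<close> divides
  the volume.
\<close>

lemma some_denominator_divisible:
  assumes p: "prime p" and q: "prime q" and pq: "p \<noteq> q" and N: "N = p * q"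
    and m: "\<And>x. x \<in> V \<Longrightarrow> m x \<in> {p, q, p * q}"
    and mint: "\<And>l x. l \<in> weight_lattice V \<Longrightarrow> x \<in> V \<Longrightarrow> real (m x) * l x \<in> \<int>"
  obtains x where "x \<in> V" "p dvd m x"
proof -
  have "\<exists>x\<in>V. p dvd m x"
  proof (rule ccontr)
    assume "\<not> (\<exists>x\<in>V. p dvd m x)"
    then have "m x = q" if "x \<in> V" for x
      using m[OF that] that by auto
    then have "N dvd q ^ CARD('n)"
      using mint by (intro volume_dvd_exponent_power) metis
    then have "p dvd q ^ CARD('n)"
      unfolding N by (rule dvd_mult_left)
    then show False
      using p q pq prime_dvd_power primes_dvd_imp_eq by blast
  qed
  then show ?thesis using that by blast
qed

text \<open>
  Modulo the integers, \<open>q / m\<close> generates the weights killed by \<open>p\<close>, and \<open>p / m\<close> those killed by \<open>q\<close>. In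
  particular they generate \<open>q * l\<close> and \<open>p * l\<close>, from which a Bezout identity recovers \<open>l\<close>.
\<close>

lemma inverse_denominators_generate:
  assumes p: "prime p" and q: "prime q" and pq: "p \<noteq> q" and N: "N = p * q"
    and m: "\<And>x. x \<in> V \<Longrightarrow> m x \<in> {p, q, p * q}"
    and mL: "(\<lambda>x. 1 / real (m x)) \<in> weight_lattice V"
    and mint: "\<And>l x. l \<in> weight_lattice V \<Longrightarrow> x \<in> V \<Longrightarrow> real (m x) * l x \<in> \<int>"
    and l: "l \<in> weight_lattice V"
  shows "\<exists>k :: int. \<forall>y\<in>V. l y - of_int k * (1 / real (m y)) \<in> \<int>"
proof -
  have pos: "p > 0" "q > 0" using p q by (auto simp: prime_gt_0_nat)
  have step: "\<exists>k :: int. \<forall>y\<in>V. real q' * l y - of_int k * (real q' * (1 / real (m y))) \<in> \<int>"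
    if p': "prime p'" and q': "prime q'" and ne: "p' \<noteq> q'" and N': "N = p' * q'"
      and m': "\<And>x. x \<in> V \<Longrightarrow> m x \<in> {p', q', p' * q'}" for p' q'
  proof -
    have ndvd: "\<not> p' dvd q'" using p' q' ne primes_dvd_imp_eq by blast
    obtain x where x: "x \<in> V" "p' dvd m x"
    proof (rule some_denominator_divisible[OF p' q' ne N'])
      show "\<And>x. x \<in> V \<Longrightarrow> m x \<in> {p', q', p' * q'}" by (rule m')
      show "\<And>l x. l \<in> weight_lattice V \<Longrightarrow> x \<in> V \<Longrightarrow> real (m x) * l x \<in> \<int>" by (rule mint)
    qed
    have mx: "m x > 0"
      using m'[OF x(1)] p' q' by (auto simp: prime_gt_0_nat)
    have "\<not> m x dvd q'"
      using x(2) ndvd dvd_trans by blast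
    then have gx: "real q' * (1 / real (m x)) \<notin> \<int>"
      using of_nat_div_in_Ints_iff[OF mx, of q'] by simp
    obtain k :: int where "\<And>y. y \<in> V \<Longrightarrow> real q' * l y - of_int k * (real q' * (1 / real (m y))) \<in> \<int>"
    proof (rule prime_torsion_cyclic[OF p' N' ndvd, of "\<lambda>y. real q' * (1 / real (m y))" "\<lambda>y. real q' * l y" x])
      show "(\<lambda>y. real q' * (1 / real (m y))) \<in> weight_lattice V"
        using mL by (rule weight_lattice_scale[rotated]) simp
      show "(\<lambda>y. real q' * l y) \<in> weight_lattice V"
        using l by (rule weight_lattice_scale[rotated]) simp
      have scaled: "real p' * (real q' * k y) \<in> \<int>" if "k \<in> weight_lattice V" "y \<in> V" for k y
        using volume_mult_weight_in_Ints[OF that] by (simp add: N' mult.assoc)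
      show "real p' * (real q' * (1 / real (m y))) \<in> \<int>" if "y \<in> V" for y
        using scaled[OF mL that] .
      show "real p' * (real q' * l y) \<in> \<int>" if "y \<in> V" for y
        using scaled[OF l that] .
    qed (use x gx in auto)
    then show ?thesis by blast
  qed
  obtain k1 :: int where k1: "\<forall>y\<in>V. real q * l y - of_int k1 * (real q * (1 / real (m y))) \<in> \<int>"
    using step[OF p q pq N m] by blast
  obtain k2 :: int where k2: "\<forall>y\<in>V. real p * l y - of_int k2 * (real p * (1 / real (m y))) \<in> \<int>"
    using step[of q p] p q pq N m by (auto simp: mult.commute insert_commute)
  have "coprime (int p) (int q)"
    using p q pq primes_coprime by auto
  then obtain s t where st: "s * int p + t * int q = 1"
    by (metis bezout_int coprime_iff_gcd_eq_1)
  have st': "of_int s * real p + of_int t * real q = 1"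
    using arg_cong[OF st, of real_of_int] by simp
  \<comment> \<open>The multiplier for \<open>p * l\<close> is \<open>k2\<close> and that for \<open>q * l\<close> is \<open>k1\<close>, and \<open>l = s * (p * l) + t * (q * l)\<close>.\<close>
  let ?k = "s * k2 * int p + t * k1 * int q"
  have "l y - of_int ?k * (1 / real (m y)) \<in> \<int>" if y: "y \<in> V" for y
  proof -
    let ?a = "1 / real (m y)"
    have "l y = (of_int s * real p + of_int t * real q) * l y"
      by (simp add: st')
    then have "l y - of_int ?k * ?a = of_int s * (real p * l y - of_int k2 * (real p * ?a)) +
        of_int t * (real q * l y - of_int k1 * (real q * ?a))"
      by (simp add: algebra_simps)
    then show ?thesis
      using k1 k2 y by simp
  qed
  then show ?thesis by blast
qed

end

section \<open>Ordering the vertices by denominator\<close>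

text \<open>
  The reciprocals of the entries of \<open>block_element\<close>.
\<close>

definition block_denominator :: "nat \<Rightarrow> nat \<Rightarrow> nat \<Rightarrow> nat \<Rightarrow> nat \<Rightarrow> nat" where
  "block_denominator p q s1 s2 i = (if i < s1 then p else if i < s1 + s2 then q else p * q)"

lemma sum_block_denominator:
  assumes "s1 + s2 + s3 = n + 1"
  shows "(\<Sum>i\<le>n. f (block_denominator p q s1 s2 i)) =
    of_nat s1 * f p + of_nat s2 * f q + of_nat s3 * (f (p * q) :: 'a::semiring_1)"
proof -
  let ?f = "\<lambda>i. f (block_denominator p q s1 s2 i)"
  have "{..n} = {0..<s1 + s2 + s3}"
    using assms by auto
  then have "sum ?f {..n} = sum ?f {0..<s1} + sum ?f {s1..<s1 + s2} + sum ?f {s1 + s2..<s1 + s2 + s3}"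
    using sum.atLeastLessThan_concat[of 0 s1 "s1 + s2" ?f]
      sum.atLeastLessThan_concat[of 0 "s1 + s2" "s1 + s2 + s3" ?f] by simp
  also have "sum ?f {0..<s1} = (\<Sum>i\<in>{0..<s1}. f p)"
    by (rule sum.cong) (auto simp: block_denominator_def)
  also have "sum ?f {s1..<s1 + s2} = (\<Sum>i\<in>{s1..<s1 + s2}. f q)"
    by (rule sum.cong) (auto simp: block_denominator_def)
  also have "sum ?f {s1 + s2..<s1 + s2 + s3} = (\<Sum>i\<in>{s1 + s2..<s1 + s2 + s3}. f (p * q))"
    by (rule sum.cong) (auto simp: block_denominator_def)
  finally show ?thesis by simp
qed

text \<open>
  This turns the condition that the weight \<open>1 / m\<close> has total \<open>r\<close> into the equation in \<open>s1, s2, s3\<close>.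
\<close>

lemma sum_inverse_block_denominators:
  assumes "s1 + s2 + s3 = n + 1" "p > 0" "q > 0"
  shows "(\<Sum>i\<le>n. 1 / real (block_denominator p q s1 s2 i)) = real r \<longleftrightarrow> r * p * q = s1 * q + s2 * p + s3"
proof -
  have "(\<Sum>i\<le>n. 1 / real (block_denominator p q s1 s2 i)) =
      real s1 * (1 / real p) + real s2 * (1 / real q) + real s3 * (1 / real (p * q))"
    using sum_block_denominator[OF assms(1), of "\<lambda>m. 1 / real m"] by simp
  also have "\<dots> = real (s1 * q + s2 * p + s3) / real (p * q)"
    using assms by (simp add: field_simps)
  also have "\<dots> = real r \<longleftrightarrow> real (s1 * q + s2 * p + s3) = real (r * p * q)"
    using assms by (simp add: divide_eq_eq mult.assoc)
  finally show ?thesis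
    by (simp only: of_nat_eq_iff) auto
qed

lemma block_element_eq_torus_point:
  assumes "s1 + s2 + s3 = n + 1"
  shows "block_element p q s1 s2 s3 = torus_point n (\<lambda>i. 1 / real (block_denominator p q s1 s2 i))"
proof -
  have "{..<s1 + s2 + s3} = {..n}"
    using assms by auto
  then show ?thesis
    unfolding block_element_def torus_point_def
    by (simp only:) (rule restrict_ext, simp add: block_denominator_def)
qed

lemma block_ordering_exists:
  fixes m :: "'a \<Rightarrow> nat"
  assumes "finite V" "card V = n + 1" and m: "\<And>x. x \<in> V \<Longrightarrow> m x \<in> {p, q, p * q}"
    and dist: "p \<noteq> q" "p * q \<noteq> p" "p * q \<noteq> q"
  obtains s1 s2 s3 v where "s1 + s2 + s3 = n + 1" "bij_betw v {..n} V"
    "\<And>i. i \<le> n \<Longrightarrow> m (v i) = block_denominator p q s1 s2 i"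
proof -
  define A where "A t = {x \<in> V. m x = t}" for t
  have fin: "finite (A t)" for t using assms(1) by (simp add: A_def)
  define s1 s2 s3 where "s1 = card (A p)" "s2 = card (A q)" "s3 = card (A (p * q))"
  have V: "V = A p \<union> A q \<union> A (p * q)"
    using m by (auto simp: A_def)
  have dis: "A p \<inter> A q = {}" "(A p \<union> A q) \<inter> A (p * q) = {}"
    using dist by (auto simp: A_def)
  have "card V = s1 + s2 + s3"
    unfolding s1_s2_s3_def by (subst V) (simp add: card_Un_disjoint fin dis)
  then have s: "s1 + s2 + s3 = n + 1" using assms(2) by simp
  obtain f1 where f1: "bij_betw f1 {..<s1} (A p)"
    using finite_same_card_bij[of "{..<s1}" "A p"] fin by (auto simp: s1_s2_s3_def)
  obtain f2 where f2: "bij_betw f2 {s1..<s1 + s2} (A q)"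
    using finite_same_card_bij[of "{s1..<s1 + s2}" "A q"] fin by (auto simp: s1_s2_s3_def)
  obtain f3 where f3: "bij_betw f3 {s1 + s2..<s1 + s2 + s3} (A (p * q))"
    using finite_same_card_bij[of "{s1 + s2..<s1 + s2 + s3}" "A (p * q)"] fin by (auto simp: s1_s2_s3_def)
  define v where "v i = (if i < s1 then f1 i else if i < s1 + s2 then f2 i else f3 i)" for i
  have "bij_betw v {..<s1} (A p)"
    using f1 by (subst bij_betw_cong[of _ v f1]) (auto simp: v_def)
  moreover have "bij_betw v {s1..<s1 + s2} (A q)"
    using f2 by (subst bij_betw_cong[of _ v f2]) (auto simp: v_def)
  moreover have "bij_betw v {s1 + s2..<s1 + s2 + s3} (A (p * q))"
    using f3 by (subst bij_betw_cong[of _ v f3]) (auto simp: v_def)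
  ultimately have "bij_betw v ({..<s1} \<union> {s1..<s1 + s2} \<union> {s1 + s2..<s1 + s2 + s3}) V"
    unfolding V using dis by (intro bij_betw_combine)
  moreover have "{..<s1} \<union> {s1..<s1 + s2} \<union> {s1 + s2..<s1 + s2 + s3} = {..n}"
    using s by auto
  ultimately have "bij_betw v {..n} V" by simp
  moreover have "m (v i) = block_denominator p q s1 s2 i" if "i \<le> n" for i
  proof -
    have "f1 i \<in> A p" if "i < s1" using f1 that by (auto simp: bij_betw_def)
    moreover have "f2 i \<in> A q" if "s1 \<le> i" "i < s1 + s2" using f2 that by (auto simp: bij_betw_def)
    moreover have "f3 i \<in> A (p * q)" if "s1 + s2 \<le> i"
      using f3 that \<open>i \<le> n\<close> s by (auto simp: bij_betw_def)
    ultimately show ?thesis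
      by (auto simp: v_def block_denominator_def A_def)
  qed
  ultimately show ?thesis using s that by blast
qed

section \<open>The characterization\<close>

theorem theorem0p3:
  fixes p q r :: nat and \<Delta> :: "(real ^ 'n) set"
  assumes "prime p" and "prime q" and "p \<noteq> q" and "r > 0"
    and "lattice_simplex CARD('n) \<Delta>"
    and "normalized_volume \<Delta> = real (p * q)"
    and "\<not> is_lattice_pyramid \<Delta>"
  shows "gorenstein r \<Delta> \<longleftrightarrow>
    (\<exists>s1 s2 s3 :: nat. s1 + s2 + s3 = CARD('n) + 1 \<and>
       r * p * q = s1 * q + s2 * p + s3 \<and>
       (\<exists>v. vertex_ordering v \<Delta> \<and>
          simplex_group v = generate (torus CARD('n)) {block_element p q s1 s2 s3}))"
proof -
  obtain V where V: "\<not> affine_dependent V" "int (card V) = int CARD('n) + 1" "\<Delta> = convex hull V"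
    using assms(5) by (auto simp: lattice_simplex_def simplex_def)
  have vert: "vertices \<Delta> = V"
    unfolding vertices_def V(3)
    using extreme_point_of_convex_hull_affine_independent[OF V(1)] by auto
  have pos: "p > 0" "q > 0" using assms(1,2) by (auto simp: prime_gt_0_nat)
  interpret simplex_of_volume V "p * q"
    using V assms(5,6) vert pos by unfold_locales (auto simp: lattice_simplex_def lattice_polytope_def)
  have ordering: "vertex_ordering v \<Delta> \<longleftrightarrow> bij_betw v {..CARD('n)} V" for v
    by (simp add: vertex_ordering_def vert)
  show ?thesis
  proof
    assume "gorenstein r \<Delta>"
    then obtain m :: "real ^ 'n \<Rightarrow> nat" where m: "\<forall>x\<in>V. m x > 0"
      and mL: "(\<lambda>x. 1 / m x) \<in> weight_lattice V" and mr: "(\<Sum>x\<in>V. 1 / m x) = real r"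
      and mint: "\<forall>l\<in>weight_lattice V. \<forall>x\<in>V. m x * l x \<in> \<int>"
      unfolding V(3) gorenstein_iff_weights[OF assms(4)] by (elim exE conjE)
    have mpq: "m x \<in> {p, q, p * q}" if x: "x \<in> V" for x
    proof -
      have "real (p * q) / real (m x) \<in> \<int>"
        using volume_mult_weight_in_Ints[OF mL x] by simp
      then have "m x dvd p * q"
        using m x by (simp only: of_nat_div_in_Ints_iff)
      then have "m x \<in> {1, p, q, p * q}"
        by (rule dvd_prime_mult_cases[OF assms(1,2)])
      moreover have "m x \<noteq> 1"
      proof
        assume "m x = 1"
        then have "l x \<in> \<int>" if "l \<in> weight_lattice V" for l
          using mint that x by fastforce
        then show False
          using pyramid_if_integral_weight[OF x] assms(7) V(3) by blast
      qed
      ultimately show ?thesis by blast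
    qed
    have "p * q \<noteq> p" "p * q \<noteq> q"
      using assms(1,2) pos by (auto simp: prime_nat_iff)
    then obtain s1 s2 s3 v where s: "s1 + s2 + s3 = CARD('n) + 1" and v: "bij_betw v {..CARD('n)} V"
      and mv: "\<And>i. i \<le> CARD('n) \<Longrightarrow> m (v i) = block_denominator p q s1 s2 i"
      using block_ordering_exists[where m = m, OF finite_V card_V mpq assms(3)] by blast
    have "(\<Sum>i\<le>CARD('n). 1 / real (block_denominator p q s1 s2 i)) = (\<Sum>i\<le>CARD('n). 1 / real (m (v i)))"
      using mv by simp
    also have "\<dots> = (\<Sum>x\<in>V. 1 / real (m x))"
      by (rule sum.reindex_bij_betw[OF v])
    finally have "r * p * q = s1 * q + s2 * p + s3"
      using mr sum_inverse_block_denominators[OF s pos] by simp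
    moreover have "simplex_group v = generate (torus CARD('n)) {block_element p q s1 s2 s3}"
      unfolding block_element_eq_torus_point[OF s]
    proof (subst simplex_group_generated_iff[OF v, of "\<lambda>x. 1 / real (m x)"])
      show "(\<lambda>x. 1 / real (m x)) \<in> weight_lattice V \<and>
          (\<forall>l\<in>weight_lattice V. \<exists>k :: int. \<forall>x\<in>V. l x - of_int k * (1 / real (m x)) \<in> \<int>)"
        using inverse_denominators_generate[OF assms(1-3) refl mpq mL] mint mL by blast
    qed (simp add: mv)
    ultimately show "\<exists>s1 s2 s3 :: nat. s1 + s2 + s3 = CARD('n) + 1 \<and>
       r * p * q = s1 * q + s2 * p + s3 \<and>
       (\<exists>v. vertex_ordering v \<Delta> \<and>
          simplex_group v = generate (torus CARD('n)) {block_element p q s1 s2 s3})"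
      using s v ordering by blast
  next
    assume "\<exists>s1 s2 s3 :: nat. s1 + s2 + s3 = CARD('n) + 1 \<and>
       r * p * q = s1 * q + s2 * p + s3 \<and>
       (\<exists>v. vertex_ordering v \<Delta> \<and>
          simplex_group v = generate (torus CARD('n)) {block_element p q s1 s2 s3})"
    then obtain s1 s2 s3 :: nat and v where s: "s1 + s2 + s3 = CARD('n) + 1"
      and rpq: "r * p * q = s1 * q + s2 * p + s3" and v: "bij_betw v {..CARD('n)} V"
      and gen: "simplex_group v = generate (torus CARD('n)) {block_element p q s1 s2 s3}"
      unfolding ordering by blast
    define m where "m x = block_denominator p q s1 s2 (inv_into {..CARD('n)} v x)" for x
    have mv: "m (v i) = block_denominator p q s1 s2 i" if "i \<le> CARD('n)" for i
      using v that by (simp add: m_def bij_betw_def)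
    have m: "m x > 0" for x
      using pos by (simp add: m_def block_denominator_def)
    have gen': "(\<lambda>x. 1 / real (m x)) \<in> weight_lattice V \<and>
        (\<forall>l\<in>weight_lattice V. \<exists>k :: int. \<forall>x\<in>V. l x - of_int k * (1 / real (m x)) \<in> \<int>)"
      using gen simplex_group_generated_iff[OF v, of "\<lambda>x. 1 / real (m x)" "\<lambda>i. 1 / real (block_denominator p q s1 s2 i)"] mv
      by (simp add: block_element_eq_torus_point[OF s])
    have "(\<Sum>x\<in>V. 1 / real (m x)) = (\<Sum>i\<le>CARD('n). 1 / real (m (v i)))"
      by (rule sum.reindex_bij_betw[OF v, symmetric])
    also have "\<dots> = (\<Sum>i\<le>CARD('n). 1 / real (block_denominator p q s1 s2 i))"
      using mv by simp
    also have "\<dots> = real r"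
      using rpq sum_inverse_block_denominators[OF s pos] by simp
    finally have mr: "(\<Sum>x\<in>V. 1 / real (m x)) = real r" .
    have mint: "real (m x) * l x \<in> \<int>" if l: "l \<in> weight_lattice V" and x: "x \<in> V" for l x
    proof -
      obtain k :: int where "l x - of_int k * (1 / real (m x)) \<in> \<int>"
        using gen' l x by blast
      then have "real (m x) * (l x - of_int k * (1 / real (m x))) + of_int k \<in> \<int>"
        by simp
      then show ?thesis
        using m[of x] by (simp add: right_diff_distrib)
    qed
    show "gorenstein r \<Delta>"
      unfolding V(3) gorenstein_iff_weights[OF assms(4)]
      using m gen' mr mint by (intro exI[of _ m] conjI ballI) auto
  qed
qed

end
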